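(* Let $\mathcal{Q}=\{(x,y): x>0,\ y>0,\ x^2+y^2=1\}$, let $\overline{\mathcal Q}$ be its closure, and define $T:\mathcal{Q}\to\overline{\mathcal{Q}}$ by $$T(x,y)=\left(\frac{|2-x-2y|}{3-2x-2y},\ \frac{|2-2x-y|}{3-2x-2y}\right).$$ Let $ds$ denote arc length on the unit circle. The dynamical system $(\mathcal{Q},T)$ possesses an infinite invariant measure $\mu$, given by $$d\mu(x,y)=\frac{ds}{\sqrt{(1-x)(1-y)}}.$$ With the measure $\mu$, the system $(\mathcal{Q},T,\mu)$ is a conservative and ergodic infinite measure-preserving system.
   Context: $T$ maps $\mathcal{Q}$ into $\mathcal{Q}$ except at the two points $(3/5,4/5)$ and $(4/5,3/5)$, which are sent to the endpoints $(1,0)$ and $(0,1)$; $T$ is regarded as a transformation of $\mathcal{Q}$ modulo null sets. Conservative and ergodic have their standard meaning in infinite ergodic theory (conservative: every measurable wandering set has measure zero; ergodic: every measurable $A$ with $T^{-1}A=A$ mod $\mu$ is null or has null complement). *)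

theory Defs
  imports "HOL-Analysis.Analysis"
begin

text \<open>
  \<open>T\<close> is a total function on the type, but only its values on \<^term>\<open>space M\<close> matter, and
  these may leave \<^term>\<open>space M\<close> on a null set. All preimages are taken within \<^term>\<open>space M\<close>; hence
  \<open>(preim M T ^^ n) A\<close> consists of the points whose first \<open>n\<close> iterates are defined
  (they stay in \<^term>\<open>space M\<close>) and whose \<open>n\<close>-th iterate lies in \<open>A\<close>, for \<open>A \<subseteq> space M\<close>.
\<close>

definition preim :: "'a measure \<Rightarrow> ('a \<Rightarrow> 'a) \<Rightarrow> 'a set \<Rightarrow> 'a set" where
  "preim M T A = T -` A \<inter> space M"

definition transformation_mod_null :: "'a measure \<Rightarrow> ('a \<Rightarrow> 'a) \<Rightarrow> bool" where
  "transformation_mod_null M T \<longleftrightarrow>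
     (AE x in M. T x \<in> space M) \<and> (\<forall>A\<in>sets M. preim M T A \<in> sets M)"

definition invariant_measure :: "'a measure \<Rightarrow> ('a \<Rightarrow> 'a) \<Rightarrow> bool" where
  "invariant_measure M T \<longleftrightarrow> (\<forall>A\<in>sets M. emeasure M (preim M T A) = emeasure M A)"

definition infinite_measure_preserving :: "'a measure \<Rightarrow> ('a \<Rightarrow> 'a) \<Rightarrow> bool" where
  "infinite_measure_preserving M T \<longleftrightarrow>
     sigma_finite_measure M \<and> emeasure M (space M) = \<infinity> \<and>
     transformation_mod_null M T \<and> invariant_measure M T"

definition wandering :: "'a measure \<Rightarrow> ('a \<Rightarrow> 'a) \<Rightarrow> 'a set \<Rightarrow> bool" where
  "wandering M T W \<longleftrightarrow> disjoint_family (\<lambda>n. (preim M T ^^ n) W)"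

definition conservative :: "'a measure \<Rightarrow> ('a \<Rightarrow> 'a) \<Rightarrow> bool" where
  "conservative M T \<longleftrightarrow> (\<forall>W\<in>sets M. wandering M T W \<longrightarrow> emeasure M W = 0)"

definition ergodic :: "'a measure \<Rightarrow> ('a \<Rightarrow> 'a) \<Rightarrow> bool" where
  "ergodic M T \<longleftrightarrow>
     (\<forall>A\<in>sets M. emeasure M ((preim M T A - A) \<union> (A - preim M T A)) = 0 \<longrightarrow>
        emeasure M A = 0 \<or> emeasure M (space M - A) = 0)"

definition quarter_circle :: "(real \<times> real) set" where
  "quarter_circle = {(x, y). x > 0 \<and> y > 0 \<and> x\<^sup>2 + y\<^sup>2 = 1}"

definition T_map :: "real \<times> real \<Rightarrow> real \<times> real" where
  "T_map = (\<lambda>(x, y). (\<bar>2 - x - 2*y\<bar> / (3 - 2*x - 2*y), \<bar>2 - 2*x - y\<bar> / (3 - 2*x - 2*y)))"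

text \<open>
  Arc length on the unit circle, as the image of Lebesgue measure under the unit-speed
  parametrisation by the angle. It is a Borel measure on the plane, concentrated on the circle.
\<close>

definition arc_length :: "(real \<times> real) measure" where
  "arc_length = distr (restrict_space lborel {0..<2*pi}) borel (\<lambda>t. (cos t, sin t))"

definition \<mu> :: "(real \<times> real) measure" where
  "\<mu> = density (restrict_space arc_length quarter_circle)
          (\<lambda>(x, y). ennreal (1 / sqrt ((1 - x) * (1 - y))))"

end

theory Submission
  imports Defs "HOL-Real_Asymp.Real_Asymp"
begin

text \<open>
  The quarter circle carries the coordinate \<open>u = y / (1 + x - y)\<close>: stereographic projection
  \<open>t = y / (1 + x)\<close>, followed by \<open>u = t / (1 - t)\<close>. It takes values in the positive half-line, and
  the endpoints \<open>(1, 0)\<close> and \<open>(0, 1)\<close> correspond to \<open>0\<close> and \<open>\<infinity>\<close>. In this coordinate \<open>\<mu>\<close> becomes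
  \<open>\<surd>2 du / u\<close>, because \<open>2 (1 - x) (1 - y) = (x + y - 1)\<^sup>2\<close> on the circle, and \<open>T\<close> becomes the map with
  the three Moebius branches \<open>u / (1 - 2 u)\<close> for \<open>u < 1/2\<close>, \<open>(1 - u) / (2 u - 1)\<close> for
  \<open>1/2 < u < 1\<close> and \<open>u - 1\<close> for \<open>u > 1\<close>, each onto the whole half-line.
  The two excluded points \<open>1/2\<close> and \<open>1\<close> are those sent to the endpoints.

  \<^emph>\<open>Invariance.\<close> The preimage of an interval consists of three intervals, and the logarithmic
  lengths of these add up to that of the given one; intervals determine the measure.

  \<^emph>\<open>Conservativity.\<close> The map has neutral fixed points at \<open>0\<close> and \<open>\<infinity>\<close>, but almost every orbit meets the
  middle interval \<open>K = (1/2, 1)\<close>, which has finite measure. Indeed, let \<open>N\<close> be the set of points whose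
  orbits avoid \<open>K\<close>, and cut it off to a compact interval \<open>[e, R]\<close>. By invariance the
  part of the preimage that lies in \<open>K\<close> accounts exactly for what the other two branches lose, and
  these lose only what crosses the ends of the window, of logarithmic size tending to \<open>0\<close> as
  \<open>e \<rightarrow> 0\<close> and \<open>R \<rightarrow> \<infinity>\<close> (\<open>leak_bound\<close>). Hence the middle preimage of \<open>N\<close> is null, and
  so is \<open>N\<close> (\<open>null_if_avoids_middle\<close>). A set of finite measure that is met by almost every orbit
  forces conservativity (\<open>conservative_if_sweep_out\<close>).

  \<^emph>\<open>Ergodicity.\<close> An inverse branch of the \<open>n\<close>-th iterate is a Moebius map with derivative
  \<open>\<plusminus>1 / (c z + d)\<^sup>2\<close>, where \<open>c \<ge> 0\<close> and \<open>d \<ge> 1\<close>. On \<open>K\<close> this varies by a factor of at most \<open>4\<close>, whatever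
  the branch (\<open>bounded_distortion\<close>). An invariant set \<open>A\<close> of positive measure meets \<open>K\<close> in
  positive measure, so it occupies a fixed proportion of every image of \<open>K\<close> under an inverse branch.
  These images form a family of nested or disjoint intervals; by recurrence to \<open>K\<close> almost every
  point lies in arbitrarily small ones (\<open>small_cylinder_exists\<close>). Therefore any open set containing the
  complement of \<open>A\<close> contains disjoint such images that cover the complement up to a
  null set, and meets \<open>A\<close> in a fixed proportion of their union. As the open set shrinks to the complement of \<open>A\<close>,
  the complement must be null (\<open>haar_ergodic\<close>).
\<close>

section \<open>Recurrence of transformations defined almost everywhere\<close>

lemma preim_iff: "x \<in> preim M T A \<longleftrightarrow> T x \<in> A \<and> x \<in> space M"
  by (simp add: preim_def)

lemma preim_pow_subset_space: "A \<subseteq> space M \<Longrightarrow> (preim M T ^^ n) A \<subseteq> space M"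
  by (cases n) (auto simp: preim_iff)

lemma preim_pow_Diff: "(preim M T ^^ n) (A - B) = (preim M T ^^ n) A - (preim M T ^^ n) B"
  by (induction n) (auto simp: preim_def)

lemma preim_pow_Int: "(preim M T ^^ n) (A \<inter> B) = (preim M T ^^ n) A \<inter> (preim M T ^^ n) B"
  by (induction n) (auto simp: preim_def)

lemma preim_pow_UN: "(preim M T ^^ n) (\<Union>i. A i) = (\<Union>i. (preim M T ^^ n) (A i))"
  by (induction n) (auto simp: preim_def)

lemma sets_preim_pow:
  assumes "transformation_mod_null M T" "A \<in> sets M"
  shows "(preim M T ^^ n) A \<in> sets M"
  using assms by (induction n) (auto simp: transformation_mod_null_def)

lemma emeasure_preim_pow:
  assumes "transformation_mod_null M T" "invariant_measure M T" "A \<in> sets M"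
  shows "emeasure M ((preim M T ^^ n) A) = emeasure M A"
  using assms sets_preim_pow[OF assms(1,3)]
  by (induction n) (auto simp: invariant_measure_def)

lemma null_sets_preim_pow:
  assumes "transformation_mod_null M T" "invariant_measure M T" "A \<in> null_sets M"
  shows "(preim M T ^^ n) A \<in> null_sets M"
  using assms emeasure_preim_pow[OF assms(1,2)] sets_preim_pow[OF assms(1)]
  by (auto simp: null_sets_def)

text \<open>
  The points whose orbits leave the space at a later time form an iterated preimage of a null set,
  which invariance keeps null.
\<close>

lemma AE_all_iterates_defined:
  assumes "transformation_mod_null M T" "invariant_measure M T"
  shows "AE x in M. x \<in> (preim M T ^^ n) (space M)"
proof (induction n)
  case (Suc n)
  have "preim M T (space M) \<in> sets M" "AE x in M. T x \<in> space M"
    using assms(1) by (auto simp: transformation_mod_null_def)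
  then have "space M - preim M T (space M) \<in> null_sets M"
    by (subst AE_iff_null_sets) (auto simp: preim_def elim!: eventually_mono)
  then have "(preim M T ^^ n) (space M - preim M T (space M)) \<in> null_sets M"
    by (rule null_sets_preim_pow[OF assms])
  then have "AE x in M. x \<notin> (preim M T ^^ n) (space M - preim M T (space M))"
    by (rule AE_not_in)
  with Suc show ?case
    by eventually_elim (auto simp: preim_pow_Diff funpow_swap1)
qed simp

text \<open>
  A single visit is promised to almost every point, hence also to almost every point after \<open>j\<close> steps.
\<close>

lemma AE_infinitely_many_visits:
  assumes T: "transformation_mod_null M T" "invariant_measure M T"
    and K: "K \<in> sets M"
    and sweep: "space M - (\<Union>n. (preim M T ^^ n) K) \<in> null_sets M"
  shows "AE x in M. \<exists>\<^sub>\<infinity>n. x \<in> (preim M T ^^ n) K"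
proof -
  have "AE x in M. \<exists>n\<ge>j. x \<in> (preim M T ^^ n) K" for j
  proof -
    have "AE x in M. x \<notin> (preim M T ^^ j) (space M - (\<Union>n. (preim M T ^^ n) K))"
      by (intro AE_not_in null_sets_preim_pow T sweep)
    with AE_all_iterates_defined[OF T, of j] show ?thesis
    proof eventually_elim
      case (elim x)
      then obtain n where "x \<in> (preim M T ^^ j) ((preim M T ^^ n) K)"
        by (auto simp: preim_pow_Diff preim_pow_UN)
      then show ?case
        by (intro exI[of _ "j + n"]) (simp add: funpow_add)
    qed
  qed
  then show ?thesis
    by (simp add: INFM_nat_le AE_all_countable)
qed

lemma AE_invariant_pow:
  assumes T: "transformation_mod_null M T" "invariant_measure M T"
    and A: "A \<in> sets M" "(preim M T A - A) \<union> (A - preim M T A) \<in> null_sets M"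
  shows "AE x in M. x \<in> (preim M T ^^ n) A \<longleftrightarrow> x \<in> A"
proof (induction n)
  case (Suc n)
  let ?P = "preim M T"
  have "preim M T A - A \<in> null_sets M" "A - preim M T A \<in> null_sets M"
    using A T(1) by (auto intro: null_sets_subset simp: transformation_mod_null_def)
  then have "(?P ^^ n) (?P A - A) \<in> null_sets M" "(?P ^^ n) (A - ?P A) \<in> null_sets M"
    by (auto intro: null_sets_preim_pow[OF T])
  from AE_not_in[OF this(1)] AE_not_in[OF this(2)] Suc show ?case
    by eventually_elim (auto simp: preim_pow_Diff funpow_swap1)
qed simp

text \<open>
  Almost every point of a wandering set \<open>W\<close> visits \<open>K\<close> infinitely often. But the measures of the sets
  \<open>W \<inter> T\<^sup>-\<^sup>n K\<close> are summable with sum at most that of \<open>K\<close>, so by Borel--Cantelli almost no point of \<open>W\<close>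
  lies in infinitely many of them.
\<close>

lemma conservative_if_sweep_out:
  assumes T: "transformation_mod_null M T" "invariant_measure M T"
    and K: "K \<in> sets M" "emeasure M K < \<infinity>"
    and sweep: "space M - (\<Union>n. (preim M T ^^ n) K) \<in> null_sets M"
  shows "conservative M T"
  unfolding conservative_def
proof safe
  fix W assume W: "W \<in> sets M" "wandering M T W"
  let ?P = "preim M T"
  note [measurable] = K(1) W(1) sets_preim_pow[OF T(1)]
  have fin: "emeasure M (W \<inter> (?P ^^ n) K) < \<infinity>" for n
  proof -
    have "emeasure M (W \<inter> (?P ^^ n) K) \<le> emeasure M ((?P ^^ n) K)"
      by (intro emeasure_mono) auto
    then show ?thesis
      using K by (simp add: emeasure_preim_pow T)
  qed
  have bound: "(\<Sum>n<N. measure M (W \<inter> (?P ^^ n) K)) \<le> measure M K" for N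
  proof -
    \<comment> \<open>Pulling the \<open>n\<close>-th summand back \<open>N - n\<close> steps puts all of them into the same set.\<close>
    define D where "D n = (?P ^^ (N - n)) W \<inter> (?P ^^ N) K" for n
    have D: "D n \<in> sets M" for n
      by (simp add: D_def)
    have eq: "emeasure M (W \<inter> (?P ^^ n) K) = emeasure M (D n)" if "n < N" for n
    proof -
      have "emeasure M (W \<inter> (?P ^^ n) K) = emeasure M ((?P ^^ (N - n)) (W \<inter> (?P ^^ n) K))"
        by (subst emeasure_preim_pow[OF T]) auto
      also have "(?P ^^ (N - n)) (W \<inter> (?P ^^ n) K) = D n"
        using that by (simp add: preim_pow_Int D_def flip: funpow_add[THEN fun_cong, simplified])
      finally show ?thesis .
    qed
    have disj: "disjoint_family_on D {..<N}"
      unfolding disjoint_family_on_def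
    proof (intro ballI impI)
      fix m n assume "m \<in> {..<N}" "n \<in> {..<N}" "m \<noteq> n"
      then have "N - m \<noteq> N - n" by auto
      then have "(?P ^^ (N - m)) W \<inter> (?P ^^ (N - n)) W = {}"
        using W(2) by (auto simp: wandering_def disjoint_family_on_def)
      then show "D m \<inter> D n = {}"
        by (auto simp: D_def)
    qed
    have "(\<Sum>n<N. emeasure M (W \<inter> (?P ^^ n) K)) = (\<Sum>n<N. emeasure M (D n))"
      by (intro sum.cong) (auto simp: eq)
    also have "\<dots> = emeasure M (\<Union>n<N. D n)"
      using D disj by (intro sum_emeasure) auto
    also have "\<dots> \<le> emeasure M ((?P ^^ N) K)"
      by (intro emeasure_mono) (auto simp: D_def)
    also have "\<dots> = emeasure M K"
      by (simp add: emeasure_preim_pow T K)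
    finally have "(\<Sum>n<N. emeasure M (W \<inter> (?P ^^ n) K)) \<le> emeasure M K" .
    then show ?thesis
      using fin K by (simp add: emeasure_eq_ennreal_measure sum_nonneg less_top)
  qed
  have "AE x in M. eventually (\<lambda>n. x \<in> space M - (W \<inter> (?P ^^ n) K)) sequentially"
    using fin bound
    by (intro borel_cantelli_AE1 summableI_nonneg_bounded[where x="measure M K"])
       (auto simp: less_top)
  with AE_infinitely_many_visits[OF T K(1) sweep] have "AE x in M. x \<notin> W"
  proof eventually_elim
    case (elim x)
    then have "\<exists>\<^sub>\<infinity>n. x \<in> (?P ^^ n) K \<and> x \<in> space M - (W \<inter> (?P ^^ n) K)"
      by (intro INFM_conjI) (auto simp: cofinite_eq_sequentially)
    then show ?case
      by (auto dest!: INFM_EX)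
  qed
  then show "emeasure M W = 0"
    using W(1) AE_iff_null_sets[of W M] by (blast dest: null_setsD1)
qed

section \<open>Transport along factor maps\<close>

text \<open>
  The condition \<open>exits\<close> makes points leave \<open>space N\<close> wherever their lifts leave \<open>space M\<close>. With it, taking preimages
  commutes exactly, and not only modulo null sets, with pulling back along \<open>\<phi>\<close>; so wandering sets pull
  back to wandering sets.
\<close>

locale factor_map =
  fixes M :: "'a measure" and U :: "'a \<Rightarrow> 'a" and N :: "'b measure" and T :: "'b \<Rightarrow> 'b"
    and \<phi> :: "'a \<Rightarrow> 'b"
  assumes measurable_map: "\<phi> \<in> measurable M N"
    and distr_map: "distr M N \<phi> = N"
    and semiconj: "\<And>x. x \<in> space M \<Longrightarrow> U x \<in> space M \<Longrightarrow> T (\<phi> x) = \<phi> (U x)"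
    and exits: "\<And>x. x \<in> space M \<Longrightarrow> T (\<phi> x) \<in> space N \<Longrightarrow> U x \<in> space M"
begin

definition pull :: "'b set \<Rightarrow> 'a set" where
  "pull A = \<phi> -` A \<inter> space M"

lemma emeasure_pull: "A \<in> sets N \<Longrightarrow> emeasure N A = emeasure M (pull A)"
  by (subst distr_map[symmetric], subst emeasure_distr[OF measurable_map]) (auto simp: pull_def)

lemma sets_pull: "A \<in> sets N \<Longrightarrow> pull A \<in> sets M"
  unfolding pull_def by (rule measurable_sets[OF measurable_map])

lemma pull_space: "pull (space N) = space M"
  using measurable_space[OF measurable_map] by (auto simp: pull_def)

lemma pull_Diff: "pull (A - B) = pull A - pull B"
  and pull_Un: "pull (A \<union> B) = pull A \<union> pull B"
  by (auto simp: pull_def)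

lemma pull_preim:
  assumes "A \<subseteq> space N"
  shows "pull (preim N T A) = preim M U (pull A)"
proof (intro set_eqI iffI)
  fix x assume x: "x \<in> pull (preim N T A)"
  then have "U x \<in> space M"
    using assms by (intro exits) (auto simp: pull_def preim_def)
  with x semiconj[of x] show "x \<in> preim M U (pull A)"
    by (simp add: pull_def preim_def)
next
  fix x assume x: "x \<in> preim M U (pull A)"
  with semiconj[of x] measurable_space[OF measurable_map, of x] show "x \<in> pull (preim N T A)"
    by (simp add: pull_def preim_def)
qed

lemma pull_preim_pow:
  assumes "A \<subseteq> space N"
  shows "pull ((preim N T ^^ n) A) = (preim M U ^^ n) (pull A)"
proof (induction n)
  case (Suc n)
  have "(preim N T ^^ n) A \<subseteq> space N"
    using assms by (induction n) (auto simp: preim_def)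
  then show ?case
    by (simp add: pull_preim Suc)
qed simp

text \<open>
  A factor of a \<open>\<sigma>\<close>-finite measure need not be \<open>\<sigma>\<close>-finite; hence the assumption on \<open>N\<close>.
\<close>

lemma infinite_measure_preserving_factor:
  assumes "infinite_measure_preserving M U" "sigma_finite_measure N"
    and T: "\<And>A. A \<in> sets N \<Longrightarrow> preim N T A \<in> sets N"
  shows "infinite_measure_preserving N T"
proof -
  have "AE x in M. U x \<in> space M"
    using assms(1) by (auto simp: infinite_measure_preserving_def transformation_mod_null_def)
  then have "AE x in M. T (\<phi> x) \<in> space N"
    using AE_space by eventually_elim (auto simp: semiconj measurable_space[OF measurable_map])
  moreover have T_sets: "{x \<in> space N. T x \<in> space N} \<in> sets N"
    using T[OF sets.top] by (simp add: preim_def vimage_def Int_def conj_commute)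
  ultimately have "AE x in distr M N \<phi>. T x \<in> space N"
    by (subst AE_distr_iff[OF measurable_map]) (use T_sets in simp_all)
  then have "AE x in N. T x \<in> space N"
    unfolding distr_map .
  then have "transformation_mod_null N T"
    using T by (simp add: transformation_mod_null_def)
  moreover have "invariant_measure N T"
    using assms(1) T sets_pull sets.sets_into_space[of _ N]
    by (auto simp: invariant_measure_def infinite_measure_preserving_def emeasure_pull pull_preim)
  moreover have "emeasure N (space N) = \<infinity>"
    using assms(1) by (simp add: emeasure_pull pull_space infinite_measure_preserving_def)
  ultimately show ?thesis
    using assms(2) by (simp add: infinite_measure_preserving_def)
qed

lemma conservative_factor:
  assumes "conservative M U"
  shows "conservative N T"
  unfolding conservative_def
proof safe
  fix W assume W: "W \<in> sets N" "wandering N T W"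
  have "pull ((preim N T ^^ n) W) = (preim M U ^^ n) (pull W)" for n
    using W(1) sets.sets_into_space by (intro pull_preim_pow) auto
  moreover have "disjoint_family (\<lambda>n. pull ((preim N T ^^ n) W))"
    using W(2) by (fastforce simp: wandering_def disjoint_family_on_def pull_def)
  ultimately have "wandering M U (pull W)"
    by (simp add: wandering_def)
  then show "emeasure N W = 0"
    using assms W(1) by (simp add: emeasure_pull sets_pull conservative_def)
qed

lemma ergodic_factor:
  assumes "ergodic M U" and T: "\<And>A. A \<in> sets N \<Longrightarrow> preim N T A \<in> sets N"
  shows "ergodic N T"
  unfolding ergodic_def
proof (intro ballI impI)
  fix A assume A: "A \<in> sets N" and inv: "emeasure N (preim N T A - A \<union> (A - preim N T A)) = 0"
  have "pull (preim N T A) = preim M U (pull A)"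
    using A sets.sets_into_space by (intro pull_preim) auto
  then have "emeasure M (preim M U (pull A) - pull A \<union> (pull A - preim M U (pull A))) = 0"
    using inv A T by (simp add: emeasure_pull pull_Un pull_Diff)
  then show "emeasure N A = 0 \<or> emeasure N (space N - A) = 0"
    using assms(1) A by (simp add: emeasure_pull sets_pull ergodic_def pull_Diff pull_space)
qed

end

section \<open>Haar measure on the multiplicative half-line\<close>

text \<open>
  The invariant measure \<open>du / u\<close> of the multiplicative group of positive reals, scaled by \<open>\<surd>2\<close> so that it
  corresponds to the given measure on the quarter circle without a further constant.
\<close>

definition haar :: "real measure" where
  "haar = density (restrict_space lborel {0<..}) (\<lambda>u. ennreal (sqrt 2 / u))"

lemma space_haar [simp]: "space haar = {0<..}"
  by (simp add: haar_def space_restrict_space)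

lemma sets_haar: "sets haar = sets (restrict_space borel {0<..})"
  by (simp add: haar_def cong: sets_restrict_space_cong)

lemma in_sets_haar: "S \<in> sets haar \<longleftrightarrow> S \<in> sets borel \<and> S \<subseteq> {0<..}"
  by (auto simp: sets_haar sets_restrict_space_iff)

lemma emeasure_haar:
  assumes "S \<in> sets borel" "S \<subseteq> {0<..}"
  shows "emeasure haar S = (\<integral>\<^sup>+u. ennreal (sqrt 2 / u) * indicator S u \<partial>lborel)"
proof -
  have "emeasure haar S = (\<integral>\<^sup>+u. ennreal (sqrt 2 / u) * indicator S u \<partial>restrict_space lborel {0<..})"
    unfolding haar_def using assms
    by (subst emeasure_density) (auto simp: sets_restrict_space_iff intro!: measurable_restrict_space1)
  also have "\<dots> = (\<integral>\<^sup>+u. ennreal (sqrt 2 / u) * indicator S u * indicator {0<..} u \<partial>lborel)"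
    by (subst nn_integral_restrict_space) auto
  also have "\<dots> = (\<integral>\<^sup>+u. ennreal (sqrt 2 / u) * indicator S u \<partial>lborel)"
    using assms by (intro nn_integral_cong) (auto simp: indicator_def)
  finally show ?thesis .
qed

lemma emeasure_haar_0_iff:
  assumes "S \<in> sets borel" "S \<subseteq> {0<..}"
  shows "emeasure haar S = 0 \<longleftrightarrow> emeasure lborel S = 0"
proof -
  have "emeasure haar S = 0 \<longleftrightarrow> (AE u in lborel. ennreal (sqrt 2 / u) * indicator S u = 0)"
    using assms by (subst emeasure_haar) (auto simp: nn_integral_0_iff_AE)
  also have "\<dots> \<longleftrightarrow> (AE u in lborel. u \<notin> S)"
    using assms by (intro AE_cong) (auto simp: indicator_def ennreal_eq_0_iff divide_le_0_iff)
  also have "\<dots> \<longleftrightarrow> emeasure lborel S = 0"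
    using assms by (subst AE_iff_null_sets[symmetric]) (auto simp: null_sets_def)
  finally show ?thesis .
qed

lemma emeasure_haar_Icc:
  assumes "0 < a" "a \<le> b"
  shows "emeasure haar {a..b} = ennreal (sqrt 2 * (ln b - ln a))"
proof -
  have "emeasure haar {a..b} = (\<integral>\<^sup>+u. ennreal (sqrt 2 / u) * indicator {a..b} u \<partial>lborel)"
    using assms by (subst emeasure_haar) auto
  also have "\<dots> = ennreal (sqrt 2 * ln b - sqrt 2 * ln a)"
    using assms by (intro nn_integral_FTC_Icc) (auto intro!: derivative_eq_intros)
  finally show ?thesis
    by (simp add: right_diff_distrib)
qed

lemma sets_haar_generated: "sets haar = sigma_sets {0<..} {{a..b} |a b. 0 < a}"
proof
  let ?E = "range (\<lambda>(a, b). {a..b::real})"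
  have borel: "sets borel = sigma_sets UNIV ?E"
    by (subst borel_eq_atLeastAtMost) (simp add: sets_measure_of)
  then have "{0<..} \<in> sigma_sets UNIV ?E"
    by (simp flip: borel)
  then have "sets haar = sigma_sets {0<..} ((\<inter>) {0<..} ` ?E)"
    unfolding sets_haar sets_restrict_space borel by (rule sigma_sets_Int) simp
  also have "\<dots> \<subseteq> sigma_sets {0<..} {{a..b} |a b. 0 < a}"
  proof (rule sigma_sets_mono, safe)
    fix a b :: real
    have "\<exists>n. inverse (real (Suc n)) \<le> u" if "0 < u" for u :: real
      using reals_Archimedean[OF that] less_imp_le by blast
    moreover have "0 < u" if "inverse (real (Suc n)) \<le> u" for u :: real and n
      using that by (rule less_le_trans[rotated]) simp
    ultimately have "{0<..} \<inter> {a..b} = (\<Union>n. {max a (inverse (real (Suc n)))..b})"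
      by (auto simp del: of_nat_Suc)
    also have "\<dots> \<in> sigma_sets {0<..} {{a..b} |a b. 0 < a}"
      by (intro sigma_sets.Union sigma_sets.Basic) (force simp: less_max_iff_disj)
    finally show "{0<..} \<inter> {a..b} \<in> sigma_sets {0<..} {{a..b} |a b. 0 < a}" .
  qed
  finally show "sets haar \<subseteq> sigma_sets {0<..} {{a..b} |a b. 0 < a}" .
  show "sigma_sets {0<..} {{a..b} |a b. 0 < a} \<subseteq> sets haar"
  proof -
    have "{{a..b} |a b. 0 < a} \<subseteq> sets haar"
      by (auto simp: in_sets_haar)
    from sets.sigma_sets_subset[OF this] show ?thesis
      by simp
  qed
qed

lemma haar_exhaustion: "(\<Union>n. {inverse (real (Suc n))..real (Suc n)}) = {0<..}"
proof (intro equalityI subsetI)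
  fix u :: real assume "u \<in> {0<..}"
  then obtain m n where "inverse (real (Suc m)) < u" "u < real n"
    using reals_Archimedean reals_Archimedean2 by fastforce
  then have "inverse (real (Suc (max m n))) \<le> u" "u \<le> real (Suc (max m n))"
    by (auto intro: order_trans[OF le_imp_inverse_le] simp: max_def)
      (smt (verit, best) le_imp_inverse_le of_nat_le_iff of_nat_0_le_iff nle_le)
  then show "u \<in> (\<Union>n. {inverse (real (Suc n))..real (Suc n)})"
    by auto
next
  fix u :: real assume "u \<in> (\<Union>n. {inverse (real (Suc n))..real (Suc n)})"
  then obtain n where "inverse (real (Suc n)) \<le> u" by auto
  moreover have "0 < inverse (real (Suc n))" by simp
  ultimately show "u \<in> {0<..}"
    unfolding greaterThan_iff by linarith
qed

text \<open>
  Compact subintervals of the half-line form a generator that is stable under intersection. The two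
  changes of variable below reduce through this lemma to computations with end points.
\<close>

lemma haar_eqI:
  assumes "sets N = sets haar"
    and "\<And>a b. 0 < a \<Longrightarrow> a \<le> b \<Longrightarrow> emeasure N {a..b} = ennreal (sqrt 2 * (ln b - ln a))"
  shows "N = haar"
proof (rule measure_eqI_generator_eq[where E="{{a..b} |a b. 0 < a}" and \<Omega>="{0<..}"
      and A="\<lambda>n. {inverse (real (Suc n))..real (Suc n)}"])
  show "Int_stable {{a..b} |a b. 0 < (a::real)}"
    unfolding Int_stable_def
  proof safe
    fix a b c d :: real assume "0 < a" "0 < c"
    then show "\<exists>a' b'. {a..b} \<inter> {c..d} = {a'..b'} \<and> 0 < a'"
      by (intro exI[of _ "max a c"] exI[of _ "min b d"]) auto
  qed
  have "emeasure N {a..b} = emeasure haar {a..b}" if "0 < a" for a b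
    using that assms(2)[of a b] emeasure_haar_Icc[of a b] by (cases "a \<le> b") auto
  then show "emeasure N S = emeasure haar S" if "S \<in> {{a..b} |a b. 0 < a}" for S
    using that by auto
  show "emeasure N {inverse (real (Suc n))..real (Suc n)} \<noteq> \<infinity>" for n
  proof -
    have "inverse (real (Suc n)) \<le> 1" "1 \<le> real (Suc n)" by (auto simp: inverse_le_1_iff)
    then have "inverse (real (Suc n)) \<le> real (Suc n)" by linarith
    then show ?thesis by (subst assms(2)) auto
  qed
qed (auto simp: assms(1) sets_haar_generated haar_exhaustion simp del: of_nat_Suc)

lemma haar_infinite: "emeasure haar {0<..} = \<infinity>"
proof -
  have "ennreal (sqrt 2 * real n) \<le> emeasure haar {0<..}" for n :: nat
  proof -
    have "ennreal (sqrt 2 * real n) = emeasure haar {1..exp (real n)}"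
      by (subst emeasure_haar_Icc) auto
    also have "\<dots> \<le> emeasure haar {0<..}"
      by (intro emeasure_mono) (auto simp: in_sets_haar)
    finally show ?thesis .
  qed
  moreover have "real n \<le> sqrt 2 * real n" for n :: nat
    by (simp add: mult_le_cancel_right1)
  ultimately have "of_nat n \<le> emeasure haar {0<..}" for n
    by (metis ennreal_leI ennreal_of_nat_eq_real_of_nat order_trans)
  then show ?thesis
    using ennreal_Ex_less_of_nat[of "emeasure haar {0<..}"]
    by (auto simp: less_top[symmetric] linorder_not_less[symmetric])
qed

lemma sigma_finite_haar: "sigma_finite_measure haar"
proof
  have "{inverse (real (Suc n))..real (Suc n)} \<in> sets haar" for n
    using haar_exhaustion by (auto simp: in_sets_haar)
  moreover have "emeasure haar {inverse (real (Suc n))..real (Suc n)} \<noteq> \<infinity>" for n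
    by (cases "inverse (real (Suc n)) \<le> real (Suc n)") (auto simp: emeasure_haar_Icc simp del: of_nat_Suc)
  ultimately show "\<exists>A. countable A \<and> A \<subseteq> sets haar \<and> \<Union>A = space haar \<and> (\<forall>a\<in>A. emeasure haar a \<noteq> \<infinity>)"
    using haar_exhaustion
    by (intro exI[of _ "range (\<lambda>n. {inverse (real (Suc n))..real (Suc n)})"])
       (auto simp: image_subset_iff)
qed

section \<open>The piecewise Moebius map of the half-line\<close>

text \<open>
  The points \<open>1/2\<close> (where the division by zero yields \<open>0\<close>) and \<open>1\<close> are both sent to \<open>0\<close>, outside the
  half-line. This matches the two points of the quarter circle that are sent to its endpoints.
\<close>

definition U_map :: "real \<Rightarrow> real" where
  "U_map u = (if u < 1/2 then u / (1 - 2*u) else if u \<le> 1 then (1 - u) / (2*u - 1) else u - 1)"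

datatype branch = Low | Mid | Up

instance branch :: countable by countable_datatype

fun inverse_branch :: "branch \<Rightarrow> real \<Rightarrow> real" where
  "inverse_branch Low z = z / (1 + 2*z)"
| "inverse_branch Mid z = (1 + z) / (1 + 2*z)"
| "inverse_branch Up z = z + 1"

fun branch_domain :: "branch \<Rightarrow> real set" where
  "branch_domain Low = {0<..<1/2}"
| "branch_domain Mid = {1/2<..<1}"
| "branch_domain Up = {1<..}"

lemma UNIV_branch: "UNIV = {Low, Mid, Up}"
  using branch.exhaust by blast

lemma inverse_branch_in_domain: "0 < z \<Longrightarrow> inverse_branch i z \<in> branch_domain i"
  by (cases i) (auto simp: field_simps)

lemma branch_domain_pos: "u \<in> branch_domain i \<Longrightarrow> 0 < u"
  by (cases i) auto

lemma branch_domain_disjoint: "u \<in> branch_domain i \<Longrightarrow> u \<in> branch_domain j \<Longrightarrow> i = j"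
  by (cases i; cases j) auto

lemma U_map_inverse_branch: "0 < z \<Longrightarrow> U_map (inverse_branch i z) = z"
  by (cases i) (auto simp: U_map_def field_simps)

lemma inverse_branch_U_map: "u \<in> branch_domain i \<Longrightarrow> inverse_branch i (U_map u) = u"
  by (cases i) (auto simp: U_map_def field_simps)

lemma U_map_pos_iff: "0 < u \<Longrightarrow> 0 < U_map u \<longleftrightarrow> (\<exists>i. u \<in> branch_domain i)"
proof -
  assume "0 < u"
  have "(\<exists>i. u \<in> branch_domain i) \<longleftrightarrow> u \<in> branch_domain Low \<or> u \<in> branch_domain Mid \<or> u \<in> branch_domain Up"
    by (metis branch.exhaust)
  also have "\<dots> \<longleftrightarrow> 0 < U_map u"
    using \<open>0 < u\<close> by (auto simp: U_map_def zero_less_divide_iff)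
  finally show ?thesis ..
qed

lemma preim_U_map_branch:
  assumes "A \<subseteq> {0<..}"
  shows "preim haar U_map A \<inter> branch_domain i = inverse_branch i ` A"
proof (intro set_eqI iffI)
  fix u assume "u \<in> preim haar U_map A \<inter> branch_domain i"
  then show "u \<in> inverse_branch i ` A"
    by (intro image_eqI[of _ _ "U_map u"]) (auto simp: preim_def inverse_branch_U_map)
next
  fix u assume "u \<in> inverse_branch i ` A"
  then obtain z where "z \<in> A" "u = inverse_branch i z" by auto
  with assms show "u \<in> preim haar U_map A \<inter> branch_domain i"
    by (auto simp: preim_def U_map_inverse_branch inverse_branch_in_domain subset_iff
          dest: branch_domain_pos[OF inverse_branch_in_domain])
qed

lemma preim_U_map_eq:
  assumes "A \<subseteq> {0<..}"
  shows "preim haar U_map A = (\<Union>i. inverse_branch i ` A)"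
proof -
  have "preim haar U_map A = (\<Union>i. preim haar U_map A \<inter> branch_domain i)"
    using assms U_map_pos_iff by (fastforce simp: preim_def)
  then show ?thesis
    using assms by (simp add: preim_U_map_branch)
qed

lemma U_map_measurable [measurable]: "U_map \<in> borel_measurable borel"
  unfolding U_map_def by measurable

lemma preim_U_map_sets: "A \<in> sets haar \<Longrightarrow> preim haar U_map A \<in> sets haar"
  using measurable_sets_borel[OF U_map_measurable, of A]
  by (auto simp: in_sets_haar preim_def)

lemma U_map_transformation: "transformation_mod_null haar U_map"
  unfolding transformation_mod_null_def
proof safe
  have "{1/2, 1::real} \<in> null_sets haar"
    by (auto simp: null_sets_def in_sets_haar emeasure_haar_0_iff intro!: null_setsD1[OF finite_imp_null_set_lborel])
  from AE_not_in[OF this] AE_space[of haar] show "AE u in haar. U_map u \<in> space haar"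
  proof eventually_elim
    case (elim u)
    then have "u \<in> branch_domain Low \<or> u \<in> branch_domain Mid \<or> u \<in> branch_domain Up"
      by auto
    with elim show ?case
      using U_map_pos_iff[of u] by (auto simp del: branch_domain.simps)
  qed
qed (rule preim_U_map_sets)

lemma inverse_branch_mono:
  assumes "0 < x" "x \<le> (y::real)"
  shows "x / (1 + 2*x) \<le> y / (1 + 2*y)" "(1 + y) / (1 + 2*y) \<le> (1 + x) / (1 + 2*x)"
  using assms by (auto simp: divide_simps algebra_simps)

lemma inverse_branch_image_Icc:
  assumes "0 < a" "a \<le> b"
  shows "inverse_branch Low ` {a..b} = {a / (1 + 2*a)..b / (1 + 2*b)}"
    and "inverse_branch Mid ` {a..b} = {(1 + b) / (1 + 2*b)..(1 + a) / (1 + 2*a)}"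
    and "inverse_branch Up ` {a..b} = {a + 1..b + 1}"
proof -
  show "inverse_branch Low ` {a..b} = {a / (1 + 2*a)..b / (1 + 2*b)}"
  proof (intro equalityI subsetI)
    fix u assume u: "u \<in> {a / (1 + 2*a)..b / (1 + 2*b)}"
    have "b / (1 + 2*b) < 1/2" using assms by (simp add: divide_simps)
    moreover have "0 < a / (1 + 2*a)" using assms by simp
    ultimately have "0 < u" "u < 1/2" using u unfolding atLeastAtMost_iff by linarith+
    then show "u \<in> inverse_branch Low ` {a..b}"
      using u assms by (intro image_eqI[of _ _ "u / (1 - 2*u)"]) (auto simp: field_simps)
  qed (use assms inverse_branch_mono in \<open>auto simp: less_imp_le\<close>)
  show "inverse_branch Mid ` {a..b} = {(1 + b) / (1 + 2*b)..(1 + a) / (1 + 2*a)}"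
  proof (intro equalityI subsetI)
    fix u assume u: "u \<in> {(1 + b) / (1 + 2*b)..(1 + a) / (1 + 2*a)}"
    have "1/2 < (1 + b) / (1 + 2*b)" "(1 + a) / (1 + 2*a) < 1" using assms by (auto simp: field_simps)
    then have "1/2 < u" "u < 1" using u unfolding atLeastAtMost_iff by linarith+
    then show "u \<in> inverse_branch Mid ` {a..b}"
      using u assms by (intro image_eqI[of _ _ "(1 - u) / (2*u - 1)"]) (auto simp: field_simps)
  qed (use assms inverse_branch_mono in \<open>auto simp: less_imp_le\<close>)
  show "inverse_branch Up ` {a..b} = {a + 1..b + 1}"
    by (simp add: image_add_atLeastAtMost' add.commute)
qed

text \<open>
  The logarithmic lengths of the three preimages of \<open>[a, b]\<close> telescope: all factors \<open>1 + a\<close>, \<open>1 + b\<close>,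
  \<open>1 + 2 a\<close> and \<open>1 + 2 b\<close> cancel.
\<close>

lemma haar_invariant: "invariant_measure haar U_map"
proof -
  let ?P = "preim haar U_map"
  \<comment> \<open>The map is defined as a self-map of the half-line only off two points, so the push-forward is taken
    from the set of points that stay in the half-line.\<close>
  define N where "N = distr (restrict_space haar (?P {0<..})) haar U_map"
  have P: "?P {0<..} \<in> sets haar"
    by (intro preim_U_map_sets) (auto simp: in_sets_haar)
  have meas: "U_map \<in> measurable (restrict_space haar (?P {0<..})) haar"
  proof (rule measurableI)
    fix A assume A: "A \<in> sets haar"
    then have "U_map -` A \<inter> space (restrict_space haar (?P {0<..})) = ?P A"
      by (auto simp: space_restrict_space preim_def in_sets_haar)
    also have "\<dots> \<in> sets (restrict_space haar (?P {0<..}))"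
      using A P preim_U_map_sets by (subst sets_restrict_space_iff) (auto simp: preim_def in_sets_haar)
    finally show "U_map -` A \<inter> space (restrict_space haar (?P {0<..})) \<in> sets (restrict_space haar (?P {0<..}))" .
  qed (auto simp: space_restrict_space preim_def)
  have N: "emeasure N A = emeasure haar (?P A)" if A: "A \<in> sets haar" for A
  proof -
    have "emeasure N A = emeasure (restrict_space haar (?P {0<..})) (U_map -` A \<inter> space (restrict_space haar (?P {0<..})))"
      unfolding N_def using A by (rule emeasure_distr[OF meas])
    also have "U_map -` A \<inter> space (restrict_space haar (?P {0<..})) = ?P A"
      using A by (auto simp: space_restrict_space preim_def in_sets_haar)
    also have "emeasure (restrict_space haar (?P {0<..})) (?P A) = emeasure haar (?P A)"
      using A P by (intro emeasure_restrict_space) (auto simp: preim_def in_sets_haar)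
    finally show ?thesis .
  qed
  have "N = haar"
  proof (rule haar_eqI)
    fix a b :: real assume ab: "0 < a" "a \<le> b"
    let ?I = "\<lambda>i. inverse_branch i ` {a..b}"
    have sub: "{a..b} \<subseteq> {0<..}" using ab by auto
    have sets: "?I i \<in> sets haar" for i
      using ab inverse_branch_in_domain branch_domain_pos
      by (cases i) (auto simp: in_sets_haar inverse_branch_image_Icc[OF ab]
           intro: less_le_trans[rotated] simp del: inverse_branch.simps)
    have disj: "?I i \<inter> ?I j = {}" if "i \<noteq> j" for i j
      using that branch_domain_disjoint sub by (auto simp flip: preim_U_map_branch)
    have pos: "0 < 1 + 2*a" "0 < 1 + 2*b" using ab by auto
    let ?l = "ln (b / (1 + 2*b)) - ln (a / (1 + 2*a))"
    let ?m = "ln ((1 + a) / (1 + 2*a)) - ln ((1 + b) / (1 + 2*b))"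
    let ?u = "ln (b + 1) - ln (a + 1)"
    note le = inverse_branch_mono[OF ab]
    have m: "emeasure haar (?I Low) = ennreal (sqrt 2 * ?l)"
        "emeasure haar (?I Mid) = ennreal (sqrt 2 * ?m)"
        "emeasure haar (?I Up) = ennreal (sqrt 2 * ?u)"
      unfolding inverse_branch_image_Icc[OF ab] using ab le
      by (intro emeasure_haar_Icc; simp)+
    have nonneg: "0 \<le> sqrt 2 * ?l" "0 \<le> sqrt 2 * ?m" "0 \<le> sqrt 2 * ?u"
      using ab le by auto
    have "?l + ?m + ?u = ln b - ln a"
      using ab by (simp add: ln_div add.commute)
    then have total: "sqrt 2 * ?l + sqrt 2 * ?m + sqrt 2 * ?u = sqrt 2 * (ln b - ln a)"
      by (simp only: distrib_left[symmetric])
    have "emeasure N {a..b} = emeasure haar (?P {a..b})"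
      using ab by (intro N) (auto simp: in_sets_haar)
    also have "?P {a..b} = ?I Low \<union> ?I Mid \<union> ?I Up"
      using preim_U_map_eq[OF sub] by (simp add: UNIV_branch Un_assoc del: inverse_branch.simps)
    also have "emeasure haar \<dots> = emeasure haar (?I Low) + emeasure haar (?I Mid) + emeasure haar (?I Up)"
      using sets disj[of Low Mid] disj[of Low Up] disj[of Mid Up]
      by (subst plus_emeasure, (auto simp del: inverse_branch.simps)[3])+ simp
    also have "\<dots> = ennreal (sqrt 2 * (ln b - ln a))"
      unfolding m total[symmetric] using nonneg by (simp only: ennreal_plus add_nonneg_nonneg)
    finally show "emeasure N {a..b} = ennreal (sqrt 2 * (ln b - ln a))" .
  qed (simp add: N_def)
  with N show ?thesis
    by (simp add: invariant_measure_def)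
qed

lemma haar_infinite_measure_preserving: "infinite_measure_preserving haar U_map"
  by (simp add: infinite_measure_preserving_def sigma_finite_haar haar_infinite
      U_map_transformation haar_invariant)

section \<open>Almost every orbit meets the middle interval\<close>

text \<open>
  The map sends \<open>N\<close> without \<open>1/2\<close> and \<open>1\<close> into \<open>N\<close>, so a point of \<open>N\<close> in the window \<open>[e, R]\<close> has its image
  in the same part of \<open>N\<close>, unless it jumps out of the window. By invariance the measure of that part equals that of its
  preimage; so the middle portion of the preimage can weigh no more than the points that jump out.
\<close>

lemma leak_bound:
  assumes N: "N \<in> sets haar" "N \<inter> {1/2<..<1} = {}" "N - {1/2, 1} \<subseteq> preim haar U_map N"
    and "0 < e" "e \<le> R"
  shows "emeasure haar (preim haar U_map (N \<inter> {e..R}) \<inter> {1/2<..<1})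
    \<le> ennreal (sqrt 2 * (ln (1/2) - ln (R / (1 + 2*R)))) + ennreal (sqrt 2 * ln (1 + e))"
proof -
  let ?P = "preim haar U_map" and ?K = "{1/2<..<1::real}"
  define B where "B = N \<inter> {e..R}"
  have B [measurable]: "B \<in> sets haar"
    using N by (auto simp: B_def in_sets_haar)
  have PB [measurable]: "?P B \<in> sets haar"
    by (rule preim_U_map_sets[OF B])
  have K [measurable]: "?K \<in> sets haar"
    by (auto simp: in_sets_haar)
  \<comment> \<open>The points that jump out of the window lie here: on \<open>?L\<close> the branch \<open>Low\<close> exceeds \<open>R\<close>, except at
    the end points, and on \<open>?H\<close> the branch \<open>Up\<close> falls below \<open>e\<close>, except at the upper end.\<close>
  let ?L = "{R / (1 + 2*R)..1/2}" and ?H = "{1..1 + e}"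
  have LH [measurable]: "?L \<in> sets haar" "?H \<in> sets haar"
    using assms by (auto simp: in_sets_haar intro: less_le_trans[rotated])
  have m: "emeasure haar B = emeasure haar (?P B)"
    using haar_invariant B by (simp add: invariant_measure_def)
  have "emeasure haar B \<le> emeasure haar {e..R}"
    using assms by (intro emeasure_mono) (auto simp: B_def in_sets_haar)
  also have "\<dots> < \<infinity>"
    using assms by (simp add: emeasure_haar_Icc)
  finally have fin: "emeasure haar (?P B - ?K) < \<infinity>"
    using m emeasure_mono[of "?P B - ?K" "?P B" haar] by (auto intro: le_less_trans)
  have "B \<subseteq> (?P B - ?K) \<union> (?L \<union> ?H)"
  proof
    fix u assume u: "u \<in> B"
    then have pos: "e \<le> u" "u \<le> R" "0 < u" "u \<notin> ?K" "u \<in> N"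
      using assms by (auto simp: B_def)
    have returns: "u \<in> ?P B" if "u \<noteq> 1/2" "u \<noteq> 1" "e \<le> U_map u" "U_map u \<le> R"
      using that pos N(3) by (auto simp: B_def preim_def)
    have "R / (1 + 2*R) < 1/2"
      using assms by (simp add: divide_simps)
    then have "u \<in> ?L \<union> ?H \<or> 1 + e < u \<or> u < 1/2 \<and> u < R / (1 + 2*R)"
      using pos(4) unfolding Un_iff atLeastAtMost_iff greaterThanLessThan_iff by linarith
    then consider "u \<in> ?L \<union> ?H" | "1 + e < u" | "u < 1/2" "u < R / (1 + 2*R)"
      by blast
    then show "u \<in> (?P B - ?K) \<union> (?L \<union> ?H)"
    proof cases
      case 2
      then have "u \<in> ?P B"
        using assms pos by (intro returns) (auto simp: U_map_def)
      with pos show ?thesis by simp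
    next
      case 3
      have "U_map u = u / (1 - 2*u)"
        using 3 by (simp add: U_map_def)
      moreover have "u \<le> u / (1 - 2*u)" "u / (1 - 2*u) \<le> R"
        using 3 pos assms by (auto simp: field_simps)
      ultimately have "u \<in> ?P B"
        using pos 3 by (intro returns) auto
      with pos show ?thesis by simp
    qed simp
  qed
  then have "emeasure haar B \<le> emeasure haar ((?P B - ?K) \<union> (?L \<union> ?H))"
    by (intro emeasure_mono) auto
  also have "\<dots> \<le> emeasure haar (?P B - ?K) + emeasure haar (?L \<union> ?H)"
    by (intro emeasure_subadditive) auto
  also have "\<dots> \<le> emeasure haar (?P B - ?K) + (emeasure haar ?L + emeasure haar ?H)"
    by (intro add_left_mono emeasure_subadditive) auto
  also have "emeasure haar B = emeasure haar (?P B - ?K) + emeasure haar (?P B \<inter> ?K)"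
    unfolding m by (subst plus_emeasure) (auto intro!: arg_cong[where f="emeasure haar"])
  finally have "emeasure haar (?P B \<inter> ?K) \<le> emeasure haar ?L + emeasure haar ?H"
    using fin by (auto simp: ennreal_add_left_cancel_le)
  also have "emeasure haar ?L = ennreal (sqrt 2 * (ln (1/2) - ln (R / (1 + 2*R))))"
    using assms by (intro emeasure_haar_Icc) (auto simp: field_simps)
  also have "emeasure haar ?H = ennreal (sqrt 2 * ln (1 + e))"
    using assms by (subst emeasure_haar_Icc) auto
  finally show ?thesis
    by (simp add: B_def)
qed

text \<open>
  Letting the window exhaust the half-line makes the bound on the leak tend to \<open>0\<close>, whereas the middle
  preimage of a fixed part of \<open>N\<close> can only grow with the window. So this preimage is null; the middle branch is
  differentiable and maps it back onto that part of \<open>N\<close>.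
\<close>

lemma null_if_avoids_middle:
  assumes N: "N \<in> sets haar" "N \<inter> {1/2<..<1} = {}" "N - {1/2, 1} \<subseteq> preim haar U_map N"
  shows "N \<in> null_sets haar"
proof -
  let ?P = "preim haar U_map" and ?K = "{1/2<..<1::real}"
  define B where "B n = N \<inter> {inverse (real (Suc n))..real (Suc n)}" for n
  have B: "B n \<in> sets haar" for n
    using N by (auto simp: B_def in_sets_haar)
  have mono: "B m \<subseteq> B n" if "m \<le> n" for m n
  proof -
    have "inverse (real (Suc n)) \<le> inverse (real (Suc m))" "real (Suc m) \<le> real (Suc n)"
      using that by (auto intro!: le_imp_inverse_le)
    then show ?thesis
      unfolding B_def by (intro Int_mono order_refl) auto
  qed
  have sets: "?P (B n) \<inter> ?K \<in> sets haar" for n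
    using preim_U_map_sets[OF B] by (intro sets.Int) (auto simp: in_sets_haar)
  have "emeasure haar (?P (B m) \<inter> ?K) = 0" for m
  proof -
    \<comment> \<open>The bound on the leak for \<open>e = 1 / (n + 1)\<close> and \<open>R = n + 1\<close>.\<close>
    define f where "f n = sqrt 2 * (ln (1/2) - ln (real (Suc n) / (1 + 2 * real (Suc n))))
      + sqrt 2 * ln (1 + inverse (real (Suc n)))" for n
    have "f \<longlonglongrightarrow> 0"
      unfolding f_def by real_asymp
    then have "(\<lambda>n. ennreal (f n)) \<longlonglongrightarrow> 0"
      by (metis tendsto_ennrealI ennreal_0)
    moreover have "emeasure haar (?P (B m) \<inter> ?K) \<le> ennreal (f n)" if "m \<le> n" for n
    proof -
      have "inverse (real (Suc n)) \<le> 1" "1 \<le> real (Suc n)" by (auto simp: inverse_le_1_iff)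
      then have le: "inverse (real (Suc n)) \<le> real (Suc n)" by linarith
      have "emeasure haar (?P (B m) \<inter> ?K) \<le> emeasure haar (?P (B n) \<inter> ?K)"
        using mono[OF that] by (intro emeasure_mono sets) (auto simp: preim_def)
      also have "\<dots> \<le> ennreal (sqrt 2 * (ln (1/2) - ln (real (Suc n) / (1 + 2 * real (Suc n)))))
          + ennreal (sqrt 2 * ln (1 + inverse (real (Suc n))))"
        unfolding B_def using le by (intro leak_bound[OF N]) auto
      also have "\<dots> = ennreal (f n)"
        unfolding f_def by (subst ennreal_plus) (auto simp: divide_simps)
      finally show ?thesis .
    qed
    ultimately have "emeasure haar (?P (B m) \<inter> ?K) \<le> 0"
      by (intro LIMSEQ_le_const[of _ 0]) auto
    then show ?thesis by simp
  qed
  then have null: "?P (B n) \<inter> ?K \<in> null_sets lborel" for n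
    using sets[of n] emeasure_haar_0_iff[of "?P (B n) \<inter> ?K"]
    by (simp add: null_sets_def in_sets_haar)
  have "B n \<in> null_sets haar" for n
  proof -
    let ?g = "\<lambda>u::real. (1 - u) / (2*u - 1)"
    have "negligible (?P (B n) \<inter> ?K)"
      using null[of n] by (simp add: negligible_iff_null_sets null_sets_completionI)
    moreover have "?g differentiable_on (?P (B n) \<inter> ?K)"
      unfolding differentiable_on_def by (auto intro!: derivative_intros)
    ultimately have "negligible (?g ` (?P (B n) \<inter> ?K))"
      by (intro negligible_differentiable_image_negligible) auto
    moreover have "B n \<subseteq> ?g ` (?P (B n) \<inter> ?K)"
    proof
      fix z assume z: "z \<in> B n"
      then have "0 < z" using B[of n] by (auto simp: in_sets_haar)
      have "inverse_branch Mid z \<in> ?P (B n) \<inter> branch_domain Mid"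
        using z B[of n] by (subst preim_U_map_branch) (auto simp: in_sets_haar)
      moreover have "?g (inverse_branch Mid z) = z"
        using \<open>0 < z\<close> by (simp add: field_simps)
      ultimately show "z \<in> ?g ` (?P (B n) \<inter> ?K)"
        by (intro image_eqI[of _ _ "inverse_branch Mid z"]) (auto simp del: inverse_branch.simps)
    qed
    ultimately have "negligible (B n)"
      by (rule negligible_subset)
    then have "emeasure lborel (B n) = 0"
      using B[of n] by (auto simp: negligible_iff_null_sets in_sets_haar null_sets_def)
    then show ?thesis
      using B[of n] by (auto simp: null_sets_def in_sets_haar emeasure_haar_0_iff)
  qed
  then have "(\<Union>n. B n) \<in> null_sets haar"
    by (rule null_sets_UN)
  also have "(\<Union>n. B n) = N"
  proof -
    have "(\<Union>n. B n) = N \<inter> (\<Union>n. {inverse (real (Suc n))..real (Suc n)})"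
      unfolding B_def by auto
    then show ?thesis
      using N(1) by (auto simp: haar_exhaustion in_sets_haar simp del: of_nat_Suc)
  qed
  finally show ?thesis .
qed

lemma middle_sets: "{1/2<..<1} \<in> sets haar"
  by (auto simp: in_sets_haar)

text \<open>
  The points that never visit the middle interval form a set to which the previous result applies; the points
  \<open>1/2\<close> and \<open>1\<close> belong to it, as their orbits stop at once.
\<close>

lemma middle_sweeps_out: "space haar - (\<Union>n. (preim haar U_map ^^ n) {1/2<..<1}) \<in> null_sets haar"
proof (rule null_if_avoids_middle)
  let ?P = "preim haar U_map" and ?K = "{1/2<..<1::real}"
  let ?V = "\<Union>n. (?P ^^ n) ?K"
  have "(?P ^^ n) ?K \<in> sets haar" for n
    using sets_preim_pow[OF U_map_transformation middle_sets] .
  then show "space haar - ?V \<in> sets haar"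
    by (intro sets.Diff sets.countable_UN sets.top) auto
  show "(space haar - ?V) \<inter> ?K = {}"
    using UN_upper[of 0 UNIV "\<lambda>n. (?P ^^ n) ?K"] by auto
  show "(space haar - ?V) - {1/2, 1} \<subseteq> ?P (space haar - ?V)"
  proof
    fix u assume u: "u \<in> (space haar - ?V) - {1/2, 1}"
    then have "u \<in> branch_domain Low \<or> u \<in> branch_domain Mid \<or> u \<in> branch_domain Up"
      by auto
    then have "0 < U_map u"
      using u U_map_pos_iff[of u] by (auto simp del: branch_domain.simps)
    moreover have "U_map u \<notin> (?P ^^ n) ?K" for n
    proof
      assume "U_map u \<in> (?P ^^ n) ?K"
      then have "u \<in> (?P ^^ Suc n) ?K"
        using u by (auto simp: preim_def)
      with u show False by blast
    qed
    ultimately show "u \<in> ?P (space haar - ?V)"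
      using u by (auto simp: preim_def)
  qed
qed

lemma emeasure_middle_finite: "emeasure haar {1/2<..<1} < \<infinity>"
proof -
  have "emeasure haar {1/2<..<1} \<le> emeasure haar {1/2..1}"
    by (intro emeasure_mono) (auto simp: in_sets_haar)
  also have "\<dots> < \<infinity>"
    by (subst emeasure_haar_Icc) auto
  finally show ?thesis .
qed

lemma haar_conservative: "conservative haar U_map"
  by (rule conservative_if_sweep_out[OF U_map_transformation haar_invariant middle_sets
        emeasure_middle_finite middle_sweeps_out])

section \<open>Inverse branches along words\<close>

definition word_branch :: "branch list \<Rightarrow> real \<Rightarrow> real" where
  "word_branch w = foldr inverse_branch w"

lemma word_branch_Nil [simp]: "word_branch [] z = z"
  and word_branch_Cons [simp]: "word_branch (i # w) z = inverse_branch i (word_branch w z)"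
  and word_branch_append: "word_branch (v @ w) z = word_branch v (word_branch w z)"
  by (simp_all add: word_branch_def)

declare inverse_branch.simps [simp del] branch_domain.simps [simp del]

lemma inverse_branch_pos: "0 < z \<Longrightarrow> 0 < inverse_branch i z"
  using inverse_branch_in_domain branch_domain_pos by blast

lemma word_branch_pos: "0 < z \<Longrightarrow> 0 < word_branch w z"
  by (induction w) (auto intro: inverse_branch_pos)

text \<open>
  The intervals on which the three branches are defined are disjoint, so a point determines its
  itinerary and the end of its orbit segment.
\<close>

lemma word_branch_unique:
  assumes "length v = length w" "0 < y" "0 < z" "word_branch v y = word_branch w z"
  shows "v = w \<and> y = z"
  using assms
proof (induction v w rule: list_induct2)
  case (Cons i v j w)
  have pos: "0 < word_branch v y" "0 < word_branch w z"
    using Cons.prems by (auto intro: word_branch_pos)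
  have eq: "inverse_branch i (word_branch v y) = inverse_branch j (word_branch w z)"
    using Cons.prems by simp
  then have "i = j"
    using inverse_branch_in_domain pos branch_domain_disjoint by metis
  moreover have "word_branch v y = word_branch w z"
    using eq U_map_inverse_branch pos by metis
  ultimately show ?case
    using Cons by simp
qed simp

lemma word_branch_image_subset: "word_branch w ` {0<..} \<subseteq> {0<..}"
  by (auto intro: word_branch_pos)

text \<open>
  The image of \<open>A\<close> under the inverse branch of a word is cut out of an iterated preimage by the cylinder of that
  word. This is how invariance of \<open>A\<close> is transferred to all cylinders.
\<close>

lemma word_branch_image:
  assumes "A \<subseteq> {0<..}"
  shows "word_branch w ` A = (preim haar U_map ^^ length w) A \<inter> word_branch w ` {0<..}"
proof (induction w)
  case Nil
  show ?case using assms by auto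
next
  case (Cons i w)
  let ?B = "(preim haar U_map ^^ length w) A" and ?C = "word_branch w ` {0<..}"
  have B: "?B \<subseteq> {0<..}"
    using assms preim_pow_subset_space[of A haar] by simp
  have "word_branch (i # w) ` A = inverse_branch i ` (?B \<inter> ?C)"
    using Cons by (simp add: image_image[symmetric])
  also have "\<dots> = preim haar U_map (?B \<inter> ?C) \<inter> branch_domain i"
    using B by (subst preim_U_map_branch) auto
  also have "\<dots> = preim haar U_map ?B \<inter> (preim haar U_map ?C \<inter> branch_domain i)"
    by (auto simp: preim_def)
  also have "\<dots> = preim haar U_map ?B \<inter> inverse_branch i ` ?C"
    by (simp only: preim_U_map_branch[OF word_branch_image_subset])
  also have "inverse_branch i ` ?C = word_branch (i # w) ` {0<..}"
    by (simp add: image_image)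
  finally show ?case by simp
qed

lemma word_branch_image_sets: "A \<in> sets haar \<Longrightarrow> word_branch w ` A \<in> sets haar"
proof (induction w)
  case (Cons i w)
  have "word_branch (i # w) ` A = inverse_branch i ` (word_branch w ` A)"
    by (simp add: image_image)
  also have "\<dots> = preim haar U_map (word_branch w ` A) \<inter> branch_domain i"
    using Cons by (subst preim_U_map_branch) (auto simp: in_sets_haar)
  also have "\<dots> \<in> sets haar"
    using Cons branch_domain_pos
    by (intro sets.Int preim_U_map_sets) (cases i; auto simp: in_sets_haar branch_domain.simps)+
  finally show ?case .
qed simp

lemma preim_pow_word:
  assumes "A \<subseteq> {0<..}" "x \<in> (preim haar U_map ^^ n) A"
  obtains w z where "length w = n" "z \<in> A" "x = word_branch w z"
proof -
  have "\<exists>w z. length w = n \<and> z \<in> A \<and> x = word_branch w z"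
    using assms(2)
  proof (induction n arbitrary: x)
    case (Suc n)
    then have "0 < x" "U_map x \<in> (preim haar U_map ^^ n) A"
      by (simp_all add: preim_iff)
    then obtain w z where w: "length w = n" "z \<in> A" "U_map x = word_branch w z"
      using Suc.IH by blast
    then have "0 < U_map x"
      using assms(1) word_branch_pos by auto
    then obtain i where "x \<in> branch_domain i"
      using U_map_pos_iff[OF \<open>0 < x\<close>] by blast
    then have "x = word_branch (i # w) z"
      using w by (simp flip: w(3) add: inverse_branch_U_map)
    with w show ?case
      by (intro exI[of _ "i # w"] exI[of _ z]) auto
  qed auto
  with that show ?thesis by blast
qed

section \<open>Bounded distortion\<close>

text \<open>
  Composing the Moebius map of a word with one more inverse branch multiplies its matrix from the right
  by that of the branch. Only the bottom row \<open>(c, d)\<close> is tracked, because this row and the sign of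
  the determinant already determine all differences of values.
\<close>

fun denominator_step :: "real \<times> real \<Rightarrow> branch \<Rightarrow> real \<times> real" where
  "denominator_step (c, d) Low = (c + 2*d, d)"
| "denominator_step (c, d) Mid = (c + 2*d, c + d)"
| "denominator_step (c, d) Up = (c, c + d)"

definition denominator :: "branch list \<Rightarrow> real \<times> real" where
  "denominator w = foldl denominator_step (0, 1) w"

definition orientation :: "branch list \<Rightarrow> real" where
  "orientation w = (-1) ^ count_list w Mid"

lemma denominator_snoc: "denominator (w @ [i]) = denominator_step (denominator w) i"
  by (simp add: denominator_def)

lemma denominator_bounds: "0 \<le> fst (denominator w)" "1 \<le> snd (denominator w)"
proof (induction w rule: rev_induct)
  case (snoc i w)
  { case 1 show ?case using snoc by (cases "denominator w"; cases i) (auto simp: denominator_snoc) }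
  { case 2 show ?case using snoc by (cases "denominator w"; cases i) (auto simp: denominator_snoc) }
qed (auto simp: denominator_def)

text \<open>
  The classical identity for the difference of two values of a Moebius map of determinant \<open>\<plusminus>1\<close>. It yields
  the derivative, and hence the distortion, as well as the diameters of cylinders.
\<close>

lemma word_branch_diff:
  assumes "denominator w = (c, d)" "0 < x" "0 < y"
  shows "word_branch w x - word_branch w y = orientation w * (x - y) / ((c*x + d) * (c*y + d))"
  using assms
proof (induction w arbitrary: c d x y rule: rev_induct)
  case Nil
  then show ?case by (simp add: denominator_def orientation_def)
next
  case (snoc i w)
  obtain c' d' where cd: "denominator w = (c', d')"
    by (cases "denominator w")
  then have nonneg: "0 \<le> c'" "1 \<le> d'"
    using denominator_bounds[of w] by auto
  then have pos: "0 < c'*t + d'" if "0 < t" for t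
    using that by (simp add: add_nonneg_pos)
  have "word_branch (w @ [i]) x - word_branch (w @ [i]) y
      = orientation w * (inverse_branch i x - inverse_branch i y)
        / ((c' * inverse_branch i x + d') * (c' * inverse_branch i y + d'))"
    using snoc.IH[OF cd, of "inverse_branch i x" "inverse_branch i y"] snoc.prems
    by (simp add: word_branch_append inverse_branch_pos)
  also have "\<dots> = orientation (w @ [i]) * (x - y) / ((c*x + d) * (c*y + d))"
  proof (cases i)
    case Up
    then show ?thesis
      using snoc.prems cd
      by (auto simp: denominator_snoc orientation_def inverse_branch.simps algebra_simps)
  next
    case Mid
    have eq: "c' * inverse_branch Mid t + d' = (c*t + d) / (1 + 2*t)" if "0 < t" for t
      using that snoc.prems cd Mid
      by (auto simp: denominator_snoc inverse_branch.simps field_simps)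
    have "inverse_branch Mid x - inverse_branch Mid y = - (x - y) / ((1 + 2*x) * (1 + 2*y))"
      using snoc.prems Mid by (simp add: inverse_branch.simps field_simps)
    then show ?thesis
      using snoc.prems Mid by (simp add: eq orientation_def) (metis minus_diff_eq minus_divide_left mult_minus_right)
  next
    case Low
    have eq: "c' * inverse_branch Low t + d' = (c*t + d) / (1 + 2*t)" if "0 < t" for t
      using that snoc.prems cd Low
      by (auto simp: denominator_snoc inverse_branch.simps field_simps)
    have "inverse_branch Low x - inverse_branch Low y = (x - y) / ((1 + 2*x) * (1 + 2*y))"
      using snoc.prems Low by (simp add: inverse_branch.simps field_simps)
    then show ?thesis
      using snoc.prems Low by (simp add: eq orientation_def)
  qed
  finally show ?case .
qed

lemma word_branch_deriv:
  assumes "denominator w = (c, d)" "S \<subseteq> {0<..}" "x \<in> S"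
  shows "(word_branch w has_field_derivative orientation w / (c*x + d)\<^sup>2) (at x within S)"
  unfolding has_field_derivative_iff
proof (rule Lim_transform_eventually)
  have pos: "0 < c*t + d" if "0 < t" for t
    using that denominator_bounds[of w] assms by (simp add: add_nonneg_pos)
  have x: "0 < x" using assms by auto
  show "((\<lambda>y. orientation w / ((c*y + d) * (c*x + d))) \<longlongrightarrow> orientation w / (c*x + d)\<^sup>2) (at x within S)"
    using pos[OF x] unfolding power2_eq_square by (auto intro!: tendsto_intros)
  show "\<forall>\<^sub>F y in at x within S. orientation w / ((c*y + d) * (c*x + d))
      = (word_branch w y - word_branch w x) / (y - x)"
    unfolding eventually_at_filter
  proof (intro always_eventually allI impI)
    fix y assume "y \<noteq> x" "y \<in> S"
    then show "orientation w / ((c*y + d) * (c*x + d)) = (word_branch w y - word_branch w x) / (y - x)"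
      using assms x by (subst word_branch_diff[OF assms(1)]) auto
  qed
qed

text \<open>
  For \<open>1/2 < x < 1\<close> one has \<open>(c + d) / 2 \<le> c x + d \<le> c + d\<close>, which confines the modulus of the
  derivative to the range from \<open>1 / (c + d)\<^sup>2\<close> to \<open>4 / (c + d)\<^sup>2\<close>.
\<close>

lemma word_branch_measure_bounds:
  assumes w: "denominator w = (c, d)" and S: "S \<in> sets borel" "S \<subseteq> {1/2<..<1}"
  shows "measure lebesgue S / (c + d)\<^sup>2 \<le> measure lebesgue (word_branch w ` S)"
    and "measure lebesgue (word_branch w ` S) \<le> 4 * measure lebesgue S / (c + d)\<^sup>2"
    and "word_branch w ` S \<in> lmeasurable"
proof -
  let ?h = "\<lambda>x. 1 / (c*x + d)\<^sup>2"
  have cd: "0 \<le> c" "1 \<le> d"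
    using denominator_bounds[of w] w by auto
  have pos: "0 < c*t + d" if "0 < t" for t
    using that cd by (simp add: add_nonneg_pos)
  have Sl: "S \<in> lmeasurable"
    using S by (intro bounded_set_imp_lmeasurable bounded_subset[OF bounded_closed_interval[of "1/2" 1]]) auto
  have "?h absolutely_integrable_on {1/2..1}"
    using pos by (intro absolutely_integrable_continuous_real continuous_intros) (auto simp: less_le)
  then have hS: "?h absolutely_integrable_on S"
    by (rule set_integrable_subset) (use S in auto)
  have abs: "\<bar>orientation w / (c*x + d)\<^sup>2\<bar> = ?h x" for x
    by (simp add: orientation_def abs_divide power_abs)
  have area: "(\<lambda>_. 1::real) absolutely_integrable_on (word_branch w ` S) \<and>
      integral (word_branch w ` S) (\<lambda>_. 1::real) = integral S ?h"
  proof (subst has_absolute_integral_change_of_variables_1'[symmetric])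
    show "S \<in> sets lebesgue" using S by simp
    show "(word_branch w has_field_derivative orientation w / (c*x + d)\<^sup>2) (at x within S)" if "x \<in> S" for x
      using S that by (intro word_branch_deriv[OF w]) auto
    show "inj_on (word_branch w) S"
      using S(2) word_branch_unique[OF refl, of _ _ w] unfolding inj_on_def
      by (meson greaterThanLessThan_iff half_gt_zero_iff less_trans subset_eq zero_less_one)
    show "(\<lambda>x. \<bar>orientation w / (c*x + d)\<^sup>2\<bar> * 1) absolutely_integrable_on S \<and>
        integral S (\<lambda>x. \<bar>orientation w / (c*x + d)\<^sup>2\<bar> * 1) = integral S ?h"
      unfolding abs using hS by simp
  qed
  from area show meas: "word_branch w ` S \<in> lmeasurable"
    by (simp add: lmeasurable_iff_integrable_on set_lebesgue_integral_eq_integral)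
  with area have eq: "measure lebesgue (word_branch w ` S) = integral S ?h"
    by (simp add: lmeasure_integral)
  have const: "integral S (\<lambda>_. k) = k * measure lebesgue S" "(\<lambda>_. k) integrable_on S" for k :: real
    using integral_mult_right[of S k "\<lambda>_. 1"] integrable_on_const[OF Sl]
    by (simp_all add: lmeasure_integral[OF Sl])
  have hi: "?h integrable_on S"
    using hS by (rule set_lebesgue_integral_eq_integral)
  have "integral S (\<lambda>_. 1 / (c + d)\<^sup>2) \<le> integral S ?h"
  proof (intro integral_le const hi)
    fix x assume "x \<in> S"
    then have "0 < x" "x \<le> 1" using S by auto
    then show "1 / (c + d)\<^sup>2 \<le> ?h x"
      using cd pos[of x] by (intro divide_left_mono power_mono) (auto simp: mult_left_le)
  qed
  then show "measure lebesgue S / (c + d)\<^sup>2 \<le> measure lebesgue (word_branch w ` S)"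
    by (simp add: eq const)
  have "integral S ?h \<le> integral S (\<lambda>_. 4 / (c + d)\<^sup>2)"
  proof (intro integral_le const hi)
    fix x assume "x \<in> S"
    then have x: "1/2 < x" using S by auto
    then have "c * (1/2) \<le> c * x" using cd by (intro mult_left_mono) auto
    then have "(c + d) / 2 \<le> c*x + d" using cd by (simp add: field_simps)
    then have "?h x \<le> 1 / ((c + d) / 2)\<^sup>2"
      using cd x pos[of x] by (intro divide_left_mono power_mono) auto
    then show "?h x \<le> 4 / (c + d)\<^sup>2"
      by (simp add: power_divide)
  qed
  then show "measure lebesgue (word_branch w ` S) \<le> 4 * measure lebesgue S / (c + d)\<^sup>2"
    by (simp add: eq const)
qed

text \<open>
  The size \<open>c + d\<close> of the word cancels between the lower bound for \<open>S\<close> and the upper bound for the whole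
  interval. The constant is \<open>2\<close> because the middle interval has length \<open>1/2\<close>.
\<close>

lemma bounded_distortion:
  assumes S: "S \<in> sets borel" "S \<subseteq> {1/2<..<1}"
  shows "emeasure lborel S * emeasure lborel (word_branch w ` {1/2<..<1})
    \<le> 2 * emeasure lborel (word_branch w ` S)"
proof -
  let ?K = "{1/2<..<1::real}"
  obtain c d where w: "denominator w = (c, d)" by (cases "denominator w")
  have "?K \<in> sets borel" by simp
  note K = word_branch_measure_bounds[OF w this order_refl]
  note S' = word_branch_measure_bounds[OF w S]
  have Sl: "S \<in> lmeasurable"
    using S by (intro bounded_set_imp_lmeasurable bounded_subset[OF bounded_closed_interval[of "1/2" 1]]) auto
  have "measure lebesgue S * measure lebesgue (word_branch w ` ?K)
      \<le> measure lebesgue S * (4 * measure lebesgue ?K / (c + d)\<^sup>2)"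
    by (intro mult_left_mono K) auto
  also have "\<dots> = 2 * (measure lebesgue S / (c + d)\<^sup>2)"
    by simp
  also have "\<dots> \<le> 2 * measure lebesgue (word_branch w ` S)"
    using S' by simp
  finally have "ennreal (measure lebesgue S * measure lebesgue (word_branch w ` ?K))
      \<le> ennreal (2 * measure lebesgue (word_branch w ` S))"
    by (rule ennreal_leI)
  then have "emeasure lebesgue S * emeasure lebesgue (word_branch w ` ?K)
      \<le> 2 * emeasure lebesgue (word_branch w ` S)"
    using Sl K(3) S'(3) by (simp add: ennreal_mult emeasure_eq_measure2)
  moreover have "word_branch w ` ?K \<in> sets borel" "word_branch w ` S \<in> sets borel"
    using S(1) subset_trans[OF S(2), of "{0<..}"]
      word_branch_image_sets[of ?K w] word_branch_image_sets[of S w]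
    by (simp_all add: in_sets_haar subset_iff)
  ultimately show ?thesis
    using S by simp
qed

text \<open>
  Controls the length of the cylinder of the word, which is of order \<open>1 / (c + d)\<^sup>2\<close>.
\<close>

definition word_size :: "branch list \<Rightarrow> real" where
  "word_size w = fst (denominator w) + snd (denominator w)"

lemma word_size_append: "word_size w \<le> word_size (w @ v)"
proof (induction v rule: rev_induct)
  case (snoc i v)
  have "word_size (w @ v) \<le> word_size (w @ v @ [i])"
    using denominator_bounds[of "w @ v"]
    by (cases "denominator (w @ v)"; cases i)
       (auto simp: word_size_def denominator_snoc simp flip: append_assoc)
  with snoc show ?case by simp
qed simp

text \<open>
  The letter \<open>Up\<close> need not increase the size: it stays at \<open>1\<close> along words in \<open>Up\<close> alone, whose
  cylinders do not shrink. Recurrence to the middle interval supplies infinitely many letters \<open>Mid\<close>.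
\<close>

lemma word_size_Mid: "word_size w + 1 \<le> word_size (w @ Mid # v)"
proof -
  have "word_size w + 1 \<le> word_size (w @ [Mid])"
    using denominator_bounds[of w]
    by (cases "denominator w") (auto simp: word_size_def denominator_snoc)
  also have "\<dots> \<le> word_size ((w @ [Mid]) @ v)"
    by (rule word_size_append)
  finally show ?thesis by simp
qed

lemma word_branch_in_middle:
  assumes "0 < z" "word_branch v z \<in> {1/2<..<1}" "v \<noteq> []"
  obtains v' where "v = Mid # v'"
proof -
  obtain i v' where v: "v = i # v'" using assms by (cases v) auto
  then have "word_branch v z \<in> branch_domain i"
    using assms by (auto intro: inverse_branch_in_domain word_branch_pos)
  then have "i = Mid"
    using assms branch_domain_disjoint[of _ i Mid] by (simp add: branch_domain.simps(2))
  with v that show ?thesis by simp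
qed

text \<open>
  If an orbit is in the middle interval at time \<open>length v\<close>, the next letter of its itinerary is \<open>Mid\<close>.
\<close>

lemma word_branch_split:
  assumes "length v < length w" "0 < y" "0 < z" "y \<in> {1/2<..<1}" "word_branch v y = word_branch w z"
  obtains w' where "w = v @ Mid # w'" "y = word_branch (Mid # w') z"
proof -
  let ?n = "length v"
  have "word_branch v y = word_branch (take ?n w) (word_branch (drop ?n w) z)"
    using assms by (simp flip: word_branch_append)
  then have eq: "v = take ?n w \<and> y = word_branch (drop ?n w) z"
    using assms by (intro word_branch_unique word_branch_pos) auto
  have "drop ?n w \<noteq> []" using assms by simp
  then obtain w' where "drop ?n w = Mid # w'"
    using word_branch_in_middle[of z "drop ?n w"] assms eq by metis
  with eq that[of w'] show ?thesis
    by (metis append_take_drop_id)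
qed

lemma long_word_exists:
  assumes "\<exists>\<^sub>\<infinity>n. x \<in> (preim haar U_map ^^ n) {1/2<..<1}"
  shows "\<exists>w. x \<in> word_branch w ` {1/2<..<1} \<and> real j \<le> word_size w"
proof (induction j)
  case 0
  obtain n where "x \<in> (preim haar U_map ^^ n) {1/2<..<1}"
    using assms by (auto dest: INFM_EX)
  then obtain w z where "z \<in> {1/2<..<1}" "x = word_branch w z"
    by (rule preim_pow_word[rotated]) auto
  moreover have "0 \<le> word_size w"
    using denominator_bounds[of w] by (simp add: word_size_def)
  ultimately show ?case by (intro exI[of _ w]) auto
next
  case (Suc j)
  then obtain w z where w: "x = word_branch w z" "z \<in> {1/2<..<1}" "real j \<le> word_size w"
    by auto
  obtain n where n: "length w < n" "x \<in> (preim haar U_map ^^ n) {1/2<..<1}"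
    using assms unfolding INFM_nat by blast
  from n(2) obtain v y where v: "length v = n" "y \<in> {1/2<..<1}" "x = word_branch v y"
    by (rule preim_pow_word[rotated]) auto
  then obtain v' where "v = w @ Mid # v'"
    using word_branch_split[of w v z y] w n by auto
  then have "real (Suc j) \<le> word_size v"
    using word_size_Mid[of w v'] w by simp
  with v show ?case by blast
qed

lemma small_cylinder_exists:
  assumes "\<exists>\<^sub>\<infinity>n. x \<in> (preim haar U_map ^^ n) {1/2<..<1}" "0 < r"
  obtains w where "x \<in> word_branch w ` {1/2<..<1}" "word_branch w ` {1/2<..<1} \<subseteq> ball x r"
proof -
  obtain j :: nat where j: "2 / r < real j"
    using reals_Archimedean2 by blast
  obtain w where w: "x \<in> word_branch w ` {1/2<..<1}" "real j \<le> word_size w"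
    using long_word_exists[OF assms(1), of j] by blast
  obtain c d where cd: "denominator w = (c, d)" by (cases "denominator w")
  have nonneg: "0 \<le> c" "1 \<le> d" using denominator_bounds[of w] cd by auto
  obtain z where z: "z \<in> {1/2<..<1}" "x = word_branch w z" using w by blast
  have "dist x y < r" if y: "y \<in> word_branch w ` {1/2<..<1}" for y
  proof -
    obtain z' where z': "z' \<in> {1/2<..<1}" "y = word_branch w z'" using y by blast
    have half: "(c + d) / 2 \<le> c*t + d" if "1/2 < t" for t
    proof -
      have "c * (1/2) \<le> c * t" using nonneg that by (intro mult_left_mono) auto
      then show ?thesis using nonneg by (simp add: field_simps)
    qed
    have "dist x y = \<bar>z - z'\<bar> / \<bar>(c*z + d) * (c*z' + d)\<bar>"
      unfolding z z' dist_real_def using z(1) z'(1)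
      by (subst word_branch_diff[OF cd]) (auto simp: orientation_def abs_mult power_abs)
    also have "\<dots> \<le> (1/2) / ((c + d) / 2 * ((c + d) / 2))"
    proof (rule frac_le)
      have "1/2 < z" "z < 1" "1/2 < z'" "z' < 1" using z z' by auto
      then show "\<bar>z - z'\<bar> \<le> 1/2" by linarith
      have "(c + d) / 2 * ((c + d) / 2) \<le> (c*z + d) * (c*z' + d)"
        using half[of z] half[of z'] z z' nonneg by (intro mult_mono) auto
      then show "(c + d) / 2 * ((c + d) / 2) \<le> \<bar>(c*z + d) * (c*z' + d)\<bar>" by linarith
    qed (use nonneg in auto)
    also have "\<dots> = 2 / (c + d) / (c + d)"
      using nonneg by (simp add: field_simps)
    also have "\<dots> \<le> 2 / (c + d) / 1"
      using nonneg by (intro divide_left_mono) auto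
    also have "2 / (c + d) / 1 < r"
    proof -
      have "2 / r < c + d" using j w cd by (simp add: word_size_def)
      then show ?thesis using assms nonneg by (simp add: field_simps)
    qed
    finally show ?thesis .
  qed
  then show ?thesis using that[OF w(1)] by (auto simp: subset_iff)
qed

text \<open>
  The middle interval is itself the cylinder of the one-letter word \<open>Mid\<close>. So the sets considered here are
  cylinders, and of two cylinders that meet, the one with the longer word lies in the other.
\<close>

lemma nested_cylinders:
  assumes "length v < length w" "word_branch v ` {1/2<..<1} \<inter> word_branch w ` {1/2<..<1} \<noteq> {}"
  shows "word_branch w ` {1/2<..<1} \<subseteq> word_branch v ` {1/2<..<1}"
proof -
  obtain y z where yz: "y \<in> {1/2<..<1}" "z \<in> {1/2<..<1}" "word_branch v y = word_branch w z"
    using assms by blast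
  then obtain w' where w': "w = v @ Mid # w'"
    using word_branch_split[OF assms(1), of y z] by auto
  have "word_branch (Mid # w') t \<in> {1/2<..<1}" if "t \<in> {1/2<..<1}" for t
    using that inverse_branch_in_domain[of "word_branch w' t" Mid] word_branch_pos[of t w']
    by (auto simp: branch_domain.simps)
  then show ?thesis
    unfolding w' word_branch_append by (auto simp del: word_branch_Cons)
qed

lemma disjoint_cylinders:
  assumes "length v = length w" "v \<noteq> w"
  shows "word_branch v ` {1/2<..<1} \<inter> word_branch w ` {1/2<..<1} = {}"
  using word_branch_unique[OF assms(1)] assms(2) by fastforce

section \<open>Ergodicity on the half-line\<close>

lemma null_sets_haar: "S \<in> null_sets haar \<longleftrightarrow> S \<in> null_sets lborel \<and> S \<subseteq> {0<..}"
  using emeasure_haar_0_iff[of S] by (auto simp: null_sets_def in_sets_haar)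

lemma AE_lborel_if_AE_haar:
  assumes "AE x in haar. Q x"
  shows "AE x in lborel. 0 < x \<longrightarrow> Q x"
proof -
  from assms obtain N where N: "{x \<in> space haar. \<not> Q x} \<subseteq> N" "N \<in> null_sets haar"
    by (auto elim!: AE_E simp: null_sets_def)
  then have "AE x in lborel. x \<notin> N"
    by (intro AE_not_in) (simp add: null_sets_haar)
  then show ?thesis
    by eventually_elim (use N in auto)
qed

text \<open>
  Knopp's argument: a set that occupies a fixed proportion of every member of a family of
  intervals, from which open sets can be exhausted disjointly, has a null complement.
\<close>

lemma haar_ergodic: "ergodic haar U_map"
  unfolding ergodic_def
proof (intro ballI impI)
  let ?P = "preim haar U_map" and ?K = "{1/2<..<1::real}"
  fix A assume A: "A \<in> sets haar"
    and "emeasure haar (?P A - A \<union> (A - ?P A)) = 0"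
  then have "(?P A - A) \<union> (A - ?P A) \<in> null_sets haar"
    using preim_U_map_sets[OF A] by (auto simp: null_sets_def)
  note inv = AE_invariant_pow[OF U_map_transformation haar_invariant A this]
  note visits = AE_infinitely_many_visits[OF U_map_transformation haar_invariant middle_sets middle_sweeps_out]
  define \<alpha> where "\<alpha> = emeasure lborel (A \<inter> ?K)"
  have A_borel [measurable]: "A \<in> sets borel" and A_pos: "A \<subseteq> {0<..}"
    using A by (auto simp: in_sets_haar)
  \<comment> \<open>Almost every point of \<open>A\<close> visits the middle interval, and does so inside \<open>A\<close>.\<close>
  have A_null: "emeasure haar A = 0" if "\<alpha> = 0"
  proof -
    have "A \<inter> ?K \<in> null_sets lborel"
      using that by (auto simp: null_sets_def \<alpha>_def)
    then have "A \<inter> ?K \<in> null_sets haar"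
      using A_pos by (auto simp: null_sets_haar)
    then have "(?P ^^ n) (A \<inter> ?K) \<in> null_sets haar" for n
      by (rule null_sets_preim_pow[OF U_map_transformation haar_invariant])
    then have "AE x in haar. \<forall>n. x \<notin> (?P ^^ n) (A \<inter> ?K)"
      by (simp add: AE_all_countable AE_not_in)
    moreover have "AE x in haar. \<forall>n. x \<in> (?P ^^ n) A \<longleftrightarrow> x \<in> A"
      using inv by (simp add: AE_all_countable)
    ultimately have "AE x in haar. x \<notin> A"
      using visits by eventually_elim (auto simp: preim_pow_Int dest!: INFM_EX)
    then show ?thesis
      using A AE_iff_null_sets[of A haar] by (blast dest: null_setsD1)
  qed
  define B where "B = {0<..} - A"
  have B [measurable]: "B \<in> sets borel" and B_haar: "B \<in> sets haar"
    unfolding B_def using A by (auto simp: in_sets_haar)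
  have density: "\<alpha> * emeasure lborel (word_branch w ` ?K) \<le> 2 * emeasure lborel (A \<inter> word_branch w ` ?K)" for w
  proof -
    have "\<alpha> * emeasure lborel (word_branch w ` ?K) \<le> 2 * emeasure lborel (word_branch w ` (A \<inter> ?K))"
      unfolding \<alpha>_def by (intro bounded_distortion) auto
    also have "word_branch w ` (A \<inter> ?K) = (?P ^^ length w) A \<inter> word_branch w ` ?K"
    proof -
      have pos: "A \<inter> ?K \<subseteq> {0<..}" "?K \<subseteq> {0<..}" by auto
      show ?thesis
        unfolding word_branch_image[OF pos(1)] word_branch_image[OF pos(2)] preim_pow_Int
        by (simp add: Int_assoc)
    qed
    also have "emeasure lborel \<dots> = emeasure lborel (A \<inter> word_branch w ` ?K)"
    proof (rule emeasure_eq_AE)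
      show "AE x in lborel. x \<in> (?P ^^ length w) A \<inter> word_branch w ` ?K \<longleftrightarrow> x \<in> A \<inter> word_branch w ` ?K"
        using AE_lborel_if_AE_haar[OF inv[of "length w"]]
        by eventually_elim (auto intro: word_branch_pos)
    qed (use word_branch_image_sets[OF middle_sets, of w] A
          sets_preim_pow[OF U_map_transformation A, of "length w"] in \<open>auto simp: in_sets_haar\<close>)
    finally show ?thesis .
  qed
  have "\<alpha> * emeasure lborel B \<le> 0 + ennreal e" if "0 < e" for e
  proof -
    have "0 < e / 2" using that by simp
    from outer_regular_lborel[OF B this] obtain Q where Q: "open Q" "B \<subseteq> Q" "emeasure lborel (Q - B) < ennreal (e / 2)"
      by blast
    define G where "G = {w. word_branch w ` ?K \<subseteq> Q}"
    \<comment> \<open>The maximal cylinders inside \<open>Q\<close>, selected by word length, which makes them disjoint.\<close>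
    define F where "F = {w \<in> G. \<forall>v\<in>G. length v < length w \<longrightarrow> word_branch v ` ?K \<inter> word_branch w ` ?K = {}}"
    let ?V = "\<Union>w\<in>F. word_branch w ` ?K"
    have disj: "disjoint_family_on (\<lambda>w. word_branch w ` ?K) F"
      unfolding disjoint_family_on_def
    proof (intro ballI impI)
      fix v w assume vw: "v \<in> F" "w \<in> F" "v \<noteq> w"
      show "word_branch v ` ?K \<inter> word_branch w ` ?K = {}"
      proof (cases "length v" "length w" rule: linorder_cases)
        case equal
        then show ?thesis using vw by (intro disjoint_cylinders) auto
      qed (use vw in \<open>auto simp: F_def\<close>)
    qed
    have cyl [measurable]: "word_branch w ` ?K \<in> sets borel" for w
      using word_branch_image_sets[OF middle_sets, of w] by (simp add: in_sets_haar)
    have V [measurable]: "?V \<in> sets borel"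
      by (intro sets.countable_UN'') auto
    have cover: "x \<in> ?V" if x: "x \<in> B" "\<exists>\<^sub>\<infinity>n. x \<in> (?P ^^ n) ?K" for x
    proof -
      obtain r where r: "0 < r" "ball x r \<subseteq> Q"
        using Q x by (meson openE subsetD)
      obtain w where "x \<in> word_branch w ` ?K" "word_branch w ` ?K \<subseteq> ball x r"
        using small_cylinder_exists[OF x(2) r(1)] by blast
      then have "w \<in> G \<and> x \<in> word_branch w ` ?K"
        using r by (auto simp: G_def)
      then obtain w where w: "w \<in> G \<and> x \<in> word_branch w ` ?K"
        and min: "\<And>v. v \<in> G \<and> x \<in> word_branch v ` ?K \<Longrightarrow> length w \<le> length v"
        using exists_least_iff[of "\<lambda>n. \<exists>w. length w = n \<and> w \<in> G \<and> x \<in> word_branch w ` ?K"]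
        by (metis linorder_not_less)
      have "word_branch v ` ?K \<inter> word_branch w ` ?K = {}" if "v \<in> G" "length v < length w" for v
        using nested_cylinders[OF that(2)] w min[of v] that by (meson linorder_not_less subsetD)
      then have "w \<in> F" using w by (auto simp: F_def)
      then show ?thesis using w by blast
    qed
    have "AE x in lborel. x \<in> B \<longrightarrow> x \<in> ?V"
      using AE_lborel_if_AE_haar[OF visits]
    proof eventually_elim
      case (elim x)
      have "0 < x" if "x \<in> B" using that by (simp add: B_def)
      with elim cover[of x] show ?case by blast
    qed
    then have "emeasure lborel B \<le> emeasure lborel ?V"
      by (intro emeasure_mono_AE) auto
    then have "\<alpha> * emeasure lborel B \<le> \<alpha> * emeasure lborel ?V"
      by (rule mult_left_mono) simp
    also have "\<dots> = (\<integral>\<^sup>+w. \<alpha> * emeasure lborel (word_branch w ` ?K) \<partial>count_space F)"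
      by (subst emeasure_UN_countable[OF _ _ disj]) (auto simp: nn_integral_cmult)
    also have "\<dots> \<le> (\<integral>\<^sup>+w. 2 * emeasure lborel (A \<inter> word_branch w ` ?K) \<partial>count_space F)"
      by (intro nn_integral_mono density)
    also have "\<dots> = 2 * emeasure lborel (\<Union>w\<in>F. A \<inter> word_branch w ` ?K)"
      using disj
      by (subst emeasure_UN_countable) (auto simp: nn_integral_cmult disjoint_family_on_def)
    also have "\<dots> \<le> 2 * emeasure lborel (Q - B)"
      using Q(1) by (intro mult_left_mono emeasure_mono) (auto simp: F_def G_def B_def)
    also have "\<dots> \<le> 2 * ennreal (e / 2)"
      using Q(3) by (intro mult_left_mono) auto
    also have "\<dots> = ennreal e"
      using that ennreal_mult[of 2 "e / 2"] by simp
    finally show ?thesis by simp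
  qed
  from ennreal_le_epsilon[OF this] have "\<alpha> * emeasure lborel B \<le> 0"
    by simp
  then have "\<alpha> = 0 \<or> emeasure lborel B = 0"
    by simp
  then show "emeasure haar A = 0 \<or> emeasure haar (space haar - A) = 0"
    using A_null emeasure_haar_0_iff[of B] B_haar by (auto simp: B_def in_sets_haar)
qed

section \<open>From the half-line to the quarter circle\<close>

text \<open>
  The rational parametrization of the circle in the coordinate \<open>u\<close>, inverse to \<open>coordinate\<close> below.
\<close>

definition circle_point :: "real \<Rightarrow> real \<times> real" where
  "circle_point u = ((1 + 2*u) / (1 + 2*u + 2*u\<^sup>2), 2*u*(1 + u) / (1 + 2*u + 2*u\<^sup>2))"

text \<open>
  Stereographic projection from \<open>(-1, 0)\<close>, which gives \<open>t = y / (1 + x)\<close>, followed by \<open>t / (1 - t)\<close>.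
\<close>

definition coordinate :: "real \<times> real \<Rightarrow> real" where
  "coordinate = (\<lambda>(x, y). y / (1 + x - y))"

lemma circle_point_in: "0 < u \<Longrightarrow> circle_point u \<in> quarter_circle"
proof -
  assume u: "0 < u"
  let ?D = "1 + 2*u + 2*u\<^sup>2"
  have D: "0 < ?D" using u by (simp add: add_pos_nonneg)
  have "(1 + 2*u)\<^sup>2 + (2*u*(1 + u))\<^sup>2 = ?D\<^sup>2"
    by algebra
  then have "((1 + 2*u) / ?D)\<^sup>2 + (2*u*(1 + u) / ?D)\<^sup>2 = 1"
    using D by (simp add: power_divide add_divide_distrib[symmetric])
  then show ?thesis
    using u D by (simp add: circle_point_def quarter_circle_def)
qed

lemma coordinate_denominator_pos:
  assumes "(x, y) \<in> quarter_circle"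
  shows "0 < 1 + x - y"
proof -
  have "0 < x" "x\<^sup>2 + y\<^sup>2 = 1"
    using assms by (auto simp: quarter_circle_def)
  then have "y\<^sup>2 \<le> 1\<^sup>2"
    using zero_le_power2[of x] unfolding power_one by linarith
  then have "y \<le> 1"
    by (rule power2_le_imp_le) simp
  with \<open>0 < x\<close> show ?thesis by simp
qed

lemma coordinate_pos: "p \<in> quarter_circle \<Longrightarrow> 0 < coordinate p"
  using coordinate_denominator_pos
  by (cases p) (auto simp: coordinate_def quarter_circle_def)

lemma coordinate_circle_point:
  assumes "0 < u"
  shows "coordinate (circle_point u) = u"
proof -
  define D where "D = 1 + 2*u + 2*u\<^sup>2"
  have D: "0 < D" using assms by (simp add: D_def add_pos_nonneg)
  then have "1 + (1 + 2*u) / D - 2*u*(1 + u) / D = (D + (1 + 2*u) - 2*u*(1 + u)) / D"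
    by (simp add: add_divide_distrib diff_divide_distrib)
  also have "D + (1 + 2*u) - 2*u*(1 + u) = 2*(1 + u)"
    by (simp add: D_def power2_eq_square algebra_simps)
  finally show ?thesis
    using assms D by (simp add: circle_point_def coordinate_def flip: D_def) (simp add: field_simps)
qed

text \<open>
  Homogeneous form of the parametrization. It spares the comparison of quotients of quotients when the branches
  of the map, which are fractions in \<open>u\<close>, are substituted.
\<close>

lemma circle_point_divide:
  assumes "q \<noteq> 0"
  shows "circle_point (p / q) =
    ((q\<^sup>2 + 2*p*q) / (q\<^sup>2 + 2*p*q + 2*p\<^sup>2), 2*p*(p + q) / (q\<^sup>2 + 2*p*q + 2*p\<^sup>2))"
proof -
  have "1 + 2*(p/q) + 2*(p/q)\<^sup>2 = (q\<^sup>2 + 2*p*q + 2*p\<^sup>2) / q\<^sup>2"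
    "1 + 2*(p/q) = (q\<^sup>2 + 2*p*q) / q\<^sup>2" "2*(p/q)*(1 + p/q) = 2*p*(p + q) / q\<^sup>2"
    using assms by (simp_all add: field_simps power2_eq_square)
  then show ?thesis
    using assms unfolding circle_point_def by simp
qed

lemma circle_point_coordinate: 
  assumes "p \<in> quarter_circle"
  shows "circle_point (coordinate p) = p"
proof -
  obtain x y where p: "p = (x, y)" by (cases p)
  then have xy: "0 < x" "0 < y" "x\<^sup>2 + y\<^sup>2 = 1" using assms by (auto simp: quarter_circle_def)
  let ?s = "1 + x - y"
  have s: "?s \<noteq> 0" using coordinate_denominator_pos assms p by fastforce
  have "?s\<^sup>2 + 2*y*?s + 2*y\<^sup>2 = 2*(1 + x)" "?s\<^sup>2 + 2*y*?s = 2*(1 + x)*x"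
    using xy(3) by algebra+
  moreover have "2*y*(y + ?s) = 2*(1 + x)*y"
    by simp
  ultimately show ?thesis
    using xy by (simp add: p coordinate_def circle_point_divide[OF s]) (simp add: field_simps)
qed

lemma T_map_circle_point:
  assumes "0 < u"
  shows "T_map (circle_point u) = (\<bar>1 - 2*u\<bar> / (1 - 2*u + 2*u\<^sup>2), 2*u*\<bar>u - 1\<bar> / (1 - 2*u + 2*u\<^sup>2))"
proof -
  define D where "D = 1 + 2*u + 2*u\<^sup>2"
  let ?x = "(1 + 2*u) / D" and ?y = "2*u*(1 + u) / D"
  have D: "0 < D" using assms by (simp add: D_def add_pos_nonneg)
  have "2 - ?x - 2 * ?y = (2*D - (1 + 2*u) - 2*(2*u*(1 + u))) / D"
      "2 - 2 * ?x - ?y = (2*D - 2*(1 + 2*u) - 2*u*(1 + u)) / D"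
      "3 - 2 * ?x - 2 * ?y = (3*D - 2*(1 + 2*u) - 2*(2*u*(1 + u))) / D"
    using D by (simp_all add: diff_divide_distrib)
  moreover have "2*D - (1 + 2*u) - 2*(2*u*(1 + u)) = 1 - 2*u"
      "2*D - 2*(1 + 2*u) - 2*u*(1 + u) = 2*u*(u - 1)"
      "3*D - 2*(1 + 2*u) - 2*(2*u*(1 + u)) = 1 - 2*u + 2*u\<^sup>2"
    by (simp_all add: D_def power2_eq_square algebra_simps)
  ultimately have "T_map (circle_point u) = (\<bar>(1 - 2*u) / D\<bar> / ((1 - 2*u + 2*u\<^sup>2) / D),
      \<bar>2*u*(u - 1) / D\<bar> / ((1 - 2*u + 2*u\<^sup>2) / D))"
    unfolding T_map_def circle_point_def D_def[symmetric] by (simp only: prod.case)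
  then show ?thesis
    using D assms by (simp add: abs_divide abs_mult)
qed

text \<open>
  All three branches lead to the same numerators and denominator up to sign; the absolute values
  in the definition of \<open>T\<close> account for the choice of branch.
\<close>

lemma T_map_semiconjugate:
  assumes "0 < u" "0 < U_map u"
  shows "T_map (circle_point u) = circle_point (U_map u)"
proof -
  obtain i where i: "u \<in> branch_domain i"
    using assms U_map_pos_iff by blast
  obtain p q where pq: "U_map u = p / q" "q \<noteq> 0" "q\<^sup>2 + 2*p*q = \<bar>1 - 2*u\<bar>"
      "q\<^sup>2 + 2*p*q + 2*p\<^sup>2 = 1 - 2*u + 2*u\<^sup>2" "2*p*(p + q) = 2*u*\<bar>u - 1\<bar>"
  proof (cases i)
    case Low
    then have "0 < u" "u < 1/2" using i by (auto simp: branch_domain.simps)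
    then show ?thesis
      by (intro that[of u "1 - 2*u"]) (auto simp: U_map_def algebra_simps power2_eq_square)
  next
    case Mid
    then have "1/2 < u" "u < 1" using i by (auto simp: branch_domain.simps)
    then show ?thesis
      by (intro that[of "1 - u" "2*u - 1"]) (auto simp: U_map_def algebra_simps power2_eq_square)
  next
    case Up
    then have "1 < u" using i by (auto simp: branch_domain.simps)
    then show ?thesis
      by (intro that[of "u - 1" 1]) (auto simp: U_map_def algebra_simps power2_eq_square)
  qed
  show ?thesis
    unfolding T_map_circle_point[OF assms(1)] pq(1) circle_point_divide[OF pq(2)] pq(4)
    unfolding pq(3) pq(5) ..
qed

lemma T_map_exit:
  assumes "0 < u" "T_map (circle_point u) \<in> quarter_circle"
  shows "0 < U_map u"
proof -
  have "fst (T_map (circle_point u)) = 0 \<or> snd (T_map (circle_point u)) = 0" if "u = 1/2 \<or> u = 1"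
    using that unfolding T_map_circle_point[OF assms(1)] by auto
  then have "u \<noteq> 1/2" "u \<noteq> 1"
    using assms(2) by (auto simp: quarter_circle_def)
  with assms(1) have "u \<in> branch_domain Low \<or> u \<in> branch_domain Mid \<or> u \<in> branch_domain Up"
    by (auto simp: branch_domain.simps)
  then show ?thesis
    using U_map_pos_iff[OF assms(1)] by blast
qed

lemma closed_quarter_circle:
  assumes "0 \<le> x" "0 \<le> y" "x\<^sup>2 + y\<^sup>2 = 1"
  shows "(x, y) \<in> closure quarter_circle"
proof -
  obtain t where t: "0 \<le> t" "t \<le> pi/2" "x = cos t" "y = sin t"
    using sincos_total_pi_half[OF assms] by blast
  let ?f = "\<lambda>t. (cos t, sin t) :: real \<times> real"
  have "?f ` {0<..<pi/2} \<subseteq> quarter_circle"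
    by (auto simp: quarter_circle_def cos_gt_zero_pi sin_gt_zero)
  then have "?f ` closure {0<..<pi/2} \<subseteq> closure quarter_circle"
    by (intro image_closure_subset continuous_intros subset_trans[OF _ closure_subset]) auto
  with t show ?thesis
    by (auto simp: closure_greaterThanLessThan)
qed

lemma T_map_closure: "T_map ` quarter_circle \<subseteq> closure quarter_circle"
proof
  fix q assume "q \<in> T_map ` quarter_circle"
  then obtain p where p: "p \<in> quarter_circle" "q = T_map p" by blast
  define u where "u = coordinate p"
  have u: "0 < u" "q = T_map (circle_point u)"
    using p coordinate_pos by (auto simp: u_def circle_point_coordinate)
  let ?E = "1 - 2*u + 2*u\<^sup>2"
  have "?E = (1 - u)\<^sup>2 + u\<^sup>2" by (simp add: power2_eq_square algebra_simps)
  then have E: "0 < ?E"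
    using u(1) by (metis add_nonneg_pos zero_le_power2 zero_less_power)
  have "(\<bar>1 - 2*u\<bar>)\<^sup>2 + (2*u*\<bar>u - 1\<bar>)\<^sup>2 = ?E\<^sup>2"
    by (simp add: power_mult_distrib) algebra
  then have "(\<bar>1 - 2*u\<bar> / ?E)\<^sup>2 + (2*u*\<bar>u - 1\<bar> / ?E)\<^sup>2 = 1"
    using E by (simp add: power_divide add_divide_distrib[symmetric])
  then show "q \<in> closure quarter_circle"
    unfolding u(2) T_map_circle_point[OF u(1)]
    using u(1) E by (intro closed_quarter_circle) auto
qed

lemma quarter_circle_borel [measurable]: "quarter_circle \<in> sets borel"
proof -
  have "quarter_circle = {p \<in> space borel. 0 < fst p \<and> 0 < snd p \<and> (fst p)\<^sup>2 + (snd p)\<^sup>2 = (1::real)}"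
    by (auto simp: quarter_circle_def)
  also have "\<dots> \<in> sets borel"
    unfolding borel_prod[symmetric] by measurable
  finally show ?thesis .
qed

lemma coordinate_borel [measurable]: "coordinate \<in> borel_measurable borel"
  unfolding coordinate_def case_prod_beta borel_prod[symmetric] by measurable

lemma sets_arc_length: "sets arc_length = sets borel"
  by (simp add: arc_length_def)

lemma space_mu: "space \<mu> = quarter_circle"
  by (simp add: \<mu>_def space_restrict_space arc_length_def)

lemma in_sets_mu: "A \<in> sets \<mu> \<longleftrightarrow> A \<in> sets borel \<and> A \<subseteq> quarter_circle"
  by (auto simp: \<mu>_def sets_arc_length sets_restrict_space_iff)

lemma emeasure_mu:
  assumes "A \<in> sets borel" "A \<subseteq> quarter_circle"
  shows "emeasure \<mu> A = (\<integral>\<^sup>+t. ennreal (1 / sqrt ((1 - cos t) * (1 - sin t))) *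
      indicator {t \<in> {0..<2*pi}. (cos t, sin t) \<in> A} t \<partial>lborel)"
proof -
  let ?g = "\<lambda>(x, y). ennreal (1 / sqrt ((1 - x) * (1 - y)))"
  have g [measurable]: "?g \<in> borel_measurable borel"
    unfolding case_prod_beta borel_prod[symmetric] by measurable
  have [measurable]: "A \<in> sets borel" by fact
  have "emeasure \<mu> A = (\<integral>\<^sup>+p. ?g p * indicator A p \<partial>restrict_space arc_length quarter_circle)"
    unfolding \<mu>_def using assms g
    by (intro emeasure_density measurable_restrict_space1)
       (auto simp: sets_restrict_space_iff sets_arc_length cong: measurable_cong_sets)
  also have "\<dots> = (\<integral>\<^sup>+p. ?g p * indicator A p * indicator quarter_circle p \<partial>arc_length)"
    by (intro nn_integral_restrict_space) (simp add: sets_arc_length)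
  also have "\<dots> = (\<integral>\<^sup>+p. ?g p * indicator A p \<partial>arc_length)"
    using assms by (intro nn_integral_cong) (auto simp: indicator_def)
  also have "\<dots> = (\<integral>\<^sup>+t. ?g (cos t, sin t) * indicator A (cos t, sin t) \<partial>restrict_space lborel {0..<2*pi})"
    unfolding arc_length_def
    by (intro nn_integral_distr measurable_restrict_space1) measurable
  also have "\<dots> = (\<integral>\<^sup>+t. ?g (cos t, sin t) * indicator A (cos t, sin t) * indicator {0..<2*pi} t \<partial>lborel)"
    by (intro nn_integral_restrict_space) simp
  also have "\<dots> = (\<integral>\<^sup>+t. ennreal (1 / sqrt ((1 - cos t) * (1 - sin t))) *
      indicator {t \<in> {0..<2*pi}. (cos t, sin t) \<in> A} t \<partial>lborel)"
    by (intro nn_integral_cong) (auto simp: indicator_def)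
  finally show ?thesis .
qed

lemma angle_in_quarter_circle_iff:
  assumes "0 \<le> t" "t < 2*pi"
  shows "(cos t, sin t) \<in> quarter_circle \<longleftrightarrow> 0 < t \<and> t < pi/2"
proof
  assume "(cos t, sin t) \<in> quarter_circle"
  then have cs: "0 < cos t" "0 < sin t" by (auto simp: quarter_circle_def)
  have "t < pi"
    using sin_le_zero[of t] cs assms by force
  moreover have "t < pi/2"
  proof (rule ccontr)
    assume "\<not> t < pi/2"
    then have "cos t \<le> cos (pi/2)" using \<open>t < pi\<close> by (intro cos_monotone_0_pi_le) auto
    with cs show False by simp
  qed
  moreover have "t \<noteq> 0" using cs by auto
  ultimately show "0 < t \<and> t < pi/2" using assms by simp
qed (auto simp: quarter_circle_def cos_gt_zero sin_gt_zero)

lemma coordinate_angle_mono: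
  assumes "0 < s" "s < t" "t < pi/2"
  shows "coordinate (cos s, sin s) < coordinate (cos t, sin t)"
proof -
  have "(cos s, sin s) \<in> quarter_circle" "(cos t, sin t) \<in> quarter_circle"
    using assms by (auto simp: quarter_circle_def cos_gt_zero sin_gt_zero)
  then have pos: "0 < 1 + cos s - sin s" "0 < 1 + cos t - sin t"
    using coordinate_denominator_pos by blast+
  have "sin s < sin t" using assms by (intro sin_monotone_2pi) auto
  moreover have "0 < sin (t - s)" using assms by (intro sin_gt_zero) auto
  ultimately have "sin s * (1 + cos t - sin t) < sin t * (1 + cos s - sin s)"
    by (simp add: sin_diff algebra_simps)
  then show ?thesis
    using pos by (simp add: coordinate_def divide_simps mult.commute)
qed

text \<open>
  On the circle \<open>2 (1 - x) (1 - y) = (x + y - 1)\<^sup>2\<close>, so the density is rational in \<open>x\<close> and \<open>y\<close>.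
\<close>

lemma arc_density_eq:
  assumes "0 < t" "t < pi/2"
  shows "1 / sqrt ((1 - cos t) * (1 - sin t)) = sqrt 2 / (cos t + sin t - 1)" "1 < cos t + sin t"
proof -
  have cs: "0 < cos t" "0 < sin t" using assms by (auto simp: cos_gt_zero sin_gt_zero)
  have sc: "(sin t)\<^sup>2 + (cos t)\<^sup>2 = 1" by simp
  then have "(cos t + sin t)\<^sup>2 = 1 + 2 * cos t * sin t"
    by (simp add: power2_sum)
  then have "1\<^sup>2 < (cos t + sin t)\<^sup>2" using cs by simp
  then show gt: "1 < cos t + sin t" 
    by (rule power2_less_imp_less) (use cs in linarith)
  have "(c + s - 1)\<^sup>2 = 2 * ((1 - c) * (1 - s))" if "s\<^sup>2 + c\<^sup>2 = 1" for c s :: real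
    using that by algebra
  from this[OF sc] have "(1 - cos t) * (1 - sin t) = (cos t + sin t - 1)\<^sup>2 / 2"
    by simp
  then have "(1 - cos t) * (1 - sin t) = ((cos t + sin t - 1) / sqrt 2)\<^sup>2"
    by (simp add: power_divide)
  then have "sqrt ((1 - cos t) * (1 - sin t)) = \<bar>(cos t + sin t - 1) / sqrt 2\<bar>"
    by (simp only: real_sqrt_abs)
  also have "\<dots> = (cos t + sin t - 1) / sqrt 2"
    using gt by simp
  finally show "1 / sqrt ((1 - cos t) * (1 - sin t)) = sqrt 2 / (cos t + sin t - 1)"
    by simp
qed

text \<open>
  The measure has the antiderivative \<open>\<surd>2 ln u\<close> along the arc, which is what makes it the Haar measure in
  the coordinate \<open>u\<close>.
\<close>

lemma coordinate_angle_deriv: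
  assumes "0 < t" "t < pi/2"
  shows "((\<lambda>t. sqrt 2 * (ln (sin t) - ln (1 + cos t - sin t))) has_real_derivative
    1 / sqrt ((1 - cos t) * (1 - sin t))) (at t)"
proof -
  have cs: "0 < cos t" "0 < sin t" using assms by (auto simp: cos_gt_zero sin_gt_zero)
  have sc: "(sin t)\<^sup>2 + (cos t)\<^sup>2 = 1" by simp
  have "(cos t, sin t) \<in> quarter_circle" using cs by (simp add: quarter_circle_def)
  then have pos: "0 < 1 + cos t - sin t" by (rule coordinate_denominator_pos)
  have gt: "0 < cos t + sin t - 1" using arc_density_eq[OF assms] by simp
  have "(c * (1 + c - s) + (s + c) * s) * (c + s - 1) = s * (1 + c - s)"
    if "s\<^sup>2 + c\<^sup>2 = 1" for c s :: real
    using that by algebra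
  from this[OF sc] have "cos t / sin t + (sin t + cos t) / (1 + cos t - sin t) = 1 / (cos t + sin t - 1)"
    using cs pos gt by (simp add: add_frac_eq frac_eq_eq)
  then have "sqrt 2 * (cos t / sin t + (sin t + cos t) / (1 + cos t - sin t)) = 1 / sqrt ((1 - cos t) * (1 - sin t))"
    unfolding arc_density_eq(1)[OF assms] by simp
  moreover have "((\<lambda>t. sqrt 2 * (ln (sin t) - ln (1 + cos t - sin t))) has_real_derivative
     sqrt 2 * (cos t / sin t + (sin t + cos t) / (1 + cos t - sin t))) (at t)"
    using cs pos
    by (auto intro!: derivative_eq_intros simp: diff_divide_distrib add_divide_distrib)
  ultimately show ?thesis by simp
qed

lemma emeasure_mu_coordinate_Icc:
  assumes "0 < a" "a \<le> b"
  shows "emeasure \<mu> (coordinate -` {a..b} \<inter> quarter_circle) = ennreal (sqrt 2 * (ln b - ln a))"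
proof -
  have angle: "\<exists>t. 0 < t \<and> t < pi/2 \<and> coordinate (cos t, sin t) = u" if "0 < u" for u
  proof -
    obtain x y where xy: "circle_point u = (x, y)" by (cases "circle_point u")
    then have q: "(x, y) \<in> quarter_circle" using circle_point_in[OF that] by simp
    then obtain t where t: "0 \<le> t" "t \<le> pi/2" "x = cos t" "y = sin t"
      using sincos_total_pi_half[of x y] by (auto simp: quarter_circle_def)
    have "t < 2*pi" using t pi_gt_zero by linarith
    then have "0 < t \<and> t < pi/2"
      using angle_in_quarter_circle_iff[of t] t q by simp
    then show ?thesis
      using coordinate_circle_point[OF that] xy t by auto
  qed
  obtain s where s: "0 < s" "s < pi/2" "coordinate (cos s, sin s) = a" using angle assms by blast
  obtain t where t: "0 < t" "t < pi/2" "coordinate (cos t, sin t) = b" using angle[of b] assms by auto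
  have st: "s \<le> t"
    using coordinate_angle_mono[of t s] s t assms by force
  have set_eq: "{r \<in> {0..<2*pi}. (cos r, sin r) \<in> coordinate -` {a..b} \<inter> quarter_circle} = {s..t}"
  proof (intro set_eqI)
    fix r
    have "r \<in> {0..<2*pi} \<and> (cos r, sin r) \<in> quarter_circle \<longleftrightarrow> 0 < r \<and> r < pi/2"
      using angle_in_quarter_circle_iff[of r] pi_gt_zero by (auto simp del: pi_gt_zero)
    moreover have "a \<le> coordinate (cos r, sin r) \<longleftrightarrow> s \<le> r" if "0 < r" "r < pi/2"
      using coordinate_angle_mono[of r s] coordinate_angle_mono[of s r] that s
      by (cases r s rule: linorder_cases) auto
    moreover have "coordinate (cos r, sin r) \<le> b \<longleftrightarrow> r \<le> t" if "0 < r" "r < pi/2"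
      using coordinate_angle_mono[of r t] coordinate_angle_mono[of t r] that t
      by (cases r t rule: linorder_cases) auto
    ultimately show "r \<in> {r \<in> {0..<2*pi}. (cos r, sin r) \<in> coordinate -` {a..b} \<inter> quarter_circle} \<longleftrightarrow> r \<in> {s..t}"
      using s t by auto
  qed
  have ln_eq: "ln (sin r) - ln (1 + cos r - sin r) = ln (coordinate (cos r, sin r))"
    if "0 < r" "r < pi/2" for r
  proof -
    have q: "(cos r, sin r) \<in> quarter_circle"
      using that by (simp add: quarter_circle_def cos_gt_zero sin_gt_zero)
    show ?thesis
      using coordinate_denominator_pos[OF q] q
      by (simp add: coordinate_def quarter_circle_def ln_div)
  qed
  have "emeasure \<mu> (coordinate -` {a..b} \<inter> quarter_circle)
      = (\<integral>\<^sup>+r. ennreal (1 / sqrt ((1 - cos r) * (1 - sin r))) * indicator {s..t} r \<partial>lborel)"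
    unfolding set_eq[symmetric] by (intro emeasure_mu) (auto intro!: measurable_sets_borel)
  also have "\<dots> = ennreal (sqrt 2 * (ln (sin t) - ln (1 + cos t - sin t)) - sqrt 2 * (ln (sin s) - ln (1 + cos s - sin s)))"
    using s t st by (intro nn_integral_FTC_Icc coordinate_angle_deriv) auto
  also have "\<dots> = ennreal (sqrt 2 * (ln b - ln a))"
    using s t by (simp add: ln_eq right_diff_distrib)
  finally show ?thesis .
qed

lemma circle_point_measurable: "circle_point \<in> measurable haar \<mu>"
proof (rule measurableI)
  fix A assume "A \<in> sets \<mu>"
  have "circle_point \<in> borel_measurable borel"
    unfolding circle_point_def by measurable
  then show "circle_point -` A \<inter> space haar \<in> sets haar"
    using \<open>A \<in> sets \<mu>\<close> by (auto simp: in_sets_haar in_sets_mu intro: measurable_sets_borel)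
qed (auto simp: space_mu circle_point_in)

lemma coordinate_measurable: "coordinate \<in> measurable \<mu> haar"
proof (rule measurableI)
  fix A assume "A \<in> sets haar"
  with coordinate_borel show "coordinate -` A \<inter> space \<mu> \<in> sets \<mu>"
    by (auto simp: in_sets_haar in_sets_mu space_mu intro: measurable_sets_borel)
qed (auto simp: space_mu coordinate_pos)

lemma distr_coordinate: "distr \<mu> haar coordinate = haar"
proof (rule haar_eqI)
  fix a b :: real assume "0 < a" "a \<le> b"
  then show "emeasure (distr \<mu> haar coordinate) {a..b} = ennreal (sqrt 2 * (ln b - ln a))"
    by (subst emeasure_distr[OF coordinate_measurable])
       (auto simp: in_sets_haar space_mu emeasure_mu_coordinate_Icc)
qed simp

lemma distr_circle_point: "distr haar \<mu> circle_point = \<mu>"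
proof -
  have "distr haar \<mu> circle_point = distr (distr \<mu> haar coordinate) \<mu> circle_point"
    by (simp add: distr_coordinate)
  also have "\<dots> = distr \<mu> \<mu> (circle_point \<circ> coordinate)"
    by (rule distr_distr[OF circle_point_measurable coordinate_measurable])
  also have "\<dots> = distr \<mu> \<mu> (\<lambda>p. p)"
    by (intro distr_cong) (auto simp: space_mu circle_point_coordinate)
  finally show ?thesis by simp
qed

lemma sigma_finite_mu: "sigma_finite_measure \<mu>"
  using sigma_finite_measure_distr[OF _ coordinate_measurable] sigma_finite_haar
  by (simp add: distr_coordinate)

lemma preim_T_map_sets: "A \<in> sets \<mu> \<Longrightarrow> preim \<mu> T_map A \<in> sets \<mu>"
proof -
  assume "A \<in> sets \<mu>"
  moreover have "T_map \<in> borel_measurable borel"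
    unfolding T_map_def case_prod_beta borel_prod[symmetric] by measurable
  ultimately show ?thesis
    by (auto simp: preim_def in_sets_mu space_mu intro: measurable_sets_borel)
qed

interpretation circle: factor_map haar U_map \<mu> T_map circle_point
  by unfold_locales
     (auto simp: space_mu circle_point_measurable distr_circle_point T_map_semiconjugate
       intro: T_map_exit)

theorem theorem3:
  "T_map ` quarter_circle \<subseteq> closure quarter_circle \<and>
   infinite_measure_preserving \<mu> T_map \<and>
   conservative \<mu> T_map \<and>
   ergodic \<mu> T_map"
  using T_map_closure
    circle.infinite_measure_preserving_factor[OF haar_infinite_measure_preserving sigma_finite_mu preim_T_map_sets]
    circle.conservative_factor[OF haar_conservative]
    circle.ergodic_factor[OF haar_ergodic preim_T_map_sets]
  by blast

end
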